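(* Let $n$ be a positive integer with $n\equiv 3\pmod 4$. Then \[ \sum_{k=0}^{n-1}[6k+1]\frac{(q;q^2)_k^3(q;q^4)_k}{(q^2;q^2)_k(q^4;q^4)_k^3}q^{k^2+k} \equiv0\pmod{[n]\Phi_n(q)^3}. \]
   Context: For a complex number $x$ and integer $n\ge 0$, $(x;q)_n=\prod_{j=0}^{n-1}(1-xq^j)$ (with $(x;q)_0=1$). $[r]=(1-q^r)/(1-q)$ denotes the $q$-integer, and $\Phi_n(q)$ is the $n$-th cyclotomic polynomial in $q$. A congruence $A(q)\equiv B(q)\pmod{P(q)}$ between rational functions in $q$ whose denominators are coprime to the polynomial $P(q)$ means that $A(q)-B(q)$ is a rational function whose numerator is divisible by $P(q)$ and whose denominator is coprime to $P(q)$. *)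

theory Defs
  imports "HOL-Computational_Algebra.Computational_Algebra"
begin

text \<open>
  The indeterminate \<open>q\<close> is \<^term>\<open>[:0, 1:] :: complex poly\<close>, and rational functions
  in \<open>q\<close> are elements of \<^typ>\<open>complex poly fract\<close>. Divisibility and coprimality of polynomials
  with rational coefficients are unaffected by passing to complex coefficients.
\<close>

definition q_pochhammer :: "'a::comm_ring_1 \<Rightarrow> 'a \<Rightarrow> nat \<Rightarrow> 'a" where
  "q_pochhammer x q n = (\<Prod>j<n. 1 - x * q ^ j)"

text \<open>
  The constant \<^const>\<open>divide\<close> is the field division in \<^typ>\<open>complex poly fract\<close>, and
  polynomial division, here exact, in \<^typ>\<open>complex poly\<close>.
\<close>
definition q_integer :: "'a::idom_divide \<Rightarrow> nat \<Rightarrow> 'a" where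
  "q_integer q r = (1 - q ^ r) div (1 - q)"

definition cyclotomic_poly :: "nat \<Rightarrow> complex poly" where
  "cyclotomic_poly n = (\<Prod>k\<in>{k\<in>{1..n}. coprime k n}. [:- cis (2 * pi * real k / real n), 1:])"

text \<open>
  The fraction need not be reduced; asking for the reduced one would give the same notion.
\<close>
definition coprime_denom :: "complex poly fract \<Rightarrow> complex poly \<Rightarrow> bool" where
  "coprime_denom A P \<longleftrightarrow> (\<exists>u v. v \<noteq> 0 \<and> coprime v P \<and> A = Fract u v)"

definition ratfun_cong :: "complex poly fract \<Rightarrow> complex poly fract \<Rightarrow> complex poly \<Rightarrow> bool" where
  "ratfun_cong A B P \<longleftrightarrow> coprime_denom A P \<and> coprime_denom B P \<and>
     (\<exists>u v. v \<noteq> 0 \<and> coprime v P \<and> P dvd u \<and> A - B = Fract u v)"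

end

theory Submission
  imports Defs "HOL-Computational_Algebra.Field_as_Ring"
begin

text \<open>
  Up to normalisation the sum is a case of the Gasper--Rahman quadratic summation in base
  \<open>Q = q\<^sup>2\<close>, which has free parameters \<open>b\<close> and \<open>d\<close>. By a WZ pair it can be
  evaluated whenever \<open>d\<close> is an even negative power of \<open>Q\<close>; since everything is polynomial in the
  parameters, interpolation gives two further cases in which the sum vanishes, namely
  \<open>a = Q\<^bsup>-N\<^esup>\<close>, and \<open>b = Q\<^bsup>-N\<^esup>\<close> with \<open>N\<close> odd and \<open>d = a\<close>.
  Near a primitive \<open>n\<close>-th root of unity, with \<open>t\<close> a local parameter, the two-parameter sum is
  divisible by \<open>t\<close> for all \<open>b, d\<close>, by \<open>t\<^sup>2\<close> for \<open>d = q\<^bsup>1-3n\<^esup>\<close> and all \<open>b\<close>,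
  and vanishes at \<open>b = q\<^bsup>1-n\<^esup>, d = q\<close>. As \<open>w = b + Q/b\<close> changes by a multiple of
  \<open>t\<^sup>2\<close> and \<open>1/d\<close> by a multiple of \<open>t\<close> in passing from these points to \<open>b = d = q\<close>,
  the sum there is divisible by \<open>t\<^sup>4\<close>. At a root of unity of smaller order \<open>r\<close> one splits the sum
  into blocks of length \<open>r\<close>, each of which vanishes to first order relative to its common factor.
\<close>

section \<open>Transport of polynomial identities along ring homomorphisms\<close>

locale unital_ring_hom =
  fixes h :: "'a::comm_ring_1 \<Rightarrow> 'b::comm_ring_1"
  assumes hom_one: "h 1 = 1" and hom_diff: "h (x - y) = h x - h y" and hom_mult: "h (x * y) = h x * h y"
begin

lemma hom_zero: "h 0 = 0"
  using hom_diff[of 1 1] by simp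

lemma hom_add: "h (x + y) = h x + h y"
  using hom_diff[of x "0 - y"] hom_diff[of 0 y] hom_zero by simp

lemma hom_power: "h (x ^ k) = h x ^ k"
  by (induction k) (simp_all add: hom_one hom_mult)

lemma hom_sum: "h (sum g A) = (\<Sum>x\<in>A. h (g x))"
  by (induction A rule: infinite_finite_induct) (simp_all add: hom_zero hom_add)

lemma hom_prod: "h (prod g A) = (\<Prod>x\<in>A. h (g x))"
  by (induction A rule: infinite_finite_induct) (simp_all add: hom_one hom_mult)

lemmas hom_simps = hom_one hom_zero hom_diff hom_add hom_mult hom_power hom_sum hom_prod

end

lemma const_poly_power: "[:x:] ^ k = [:x ^ k:]" for x :: "'a::comm_semiring_1"
  by (induction k) (simp_all add: mult.commute one_pCons)

lemma unital_ring_hom_poly: "unital_ring_hom (\<lambda>p. poly p x)"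
  by unfold_locales simp_all

lemma unital_ring_hom_to_fract: "unital_ring_hom to_fract"
  by unfold_locales simp_all

subsection \<open>A terminating quadratic summation\<close>

text \<open>
  Here \<open>w/c\<close> stands for \<open>b + Q/b\<close> and \<open>e/f\<close> for \<open>1/d\<close>, because the parameters enter the summand only
  through these combinations: \<open>(1 - bQ\<^sup>j)(1 - Q\<^bsup>j+1\<^esup>/b) = 1 + Q\<^bsup>2j+1\<^esup> - (b + Q/b)Q\<^sup>j\<close>, and
  similarly for the denominator. Denominators are cleared, so that the sum makes sense in every
  commutative ring; the homogenising variables \<open>c, f\<close> avoid negative powers of \<open>q\<close>.
\<close>

definition rahman_num :: "'a::comm_ring_1 \<Rightarrow> 'a \<Rightarrow> 'a \<Rightarrow> 'a \<Rightarrow> 'a \<Rightarrow> 'a \<Rightarrow> nat \<Rightarrow> 'a" where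
  "rahman_num Q a w c e f j =
     (1 - a * Q ^ j) * (a * Q ^ (j + 1)) * (c * (1 + Q ^ (2 * j + 1)) - w * Q ^ j) * (e - f * Q ^ (2 * j))"

definition rahman_quad :: "'a::comm_ring_1 \<Rightarrow> 'a \<Rightarrow> 'a \<Rightarrow> 'a \<Rightarrow> nat \<Rightarrow> 'a" where
  "rahman_quad Q a w c j = c * (1 + a\<^sup>2 * Q ^ (4 * j + 3)) - w * a * Q ^ (2 * j + 1)"

definition rahman_den :: "'a::comm_ring_1 \<Rightarrow> 'a \<Rightarrow> 'a \<Rightarrow> 'a \<Rightarrow> 'a \<Rightarrow> 'a \<Rightarrow> nat \<Rightarrow> 'a" where
  "rahman_den Q a w c e f j =
     (1 - Q ^ (2 * j + 2)) * rahman_quad Q a w c j * (f - a * e * Q ^ (j + 1))"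

definition rahman_sum :: "'a::comm_ring_1 \<Rightarrow> 'a \<Rightarrow> 'a \<Rightarrow> 'a \<Rightarrow> 'a \<Rightarrow> 'a \<Rightarrow> nat \<Rightarrow> 'a" where
  "rahman_sum Q a w c e f m =
     (\<Sum>k\<le>m. (1 - a * Q ^ (3 * k)) * (\<Prod>j<k. rahman_num Q a w c e f j)
        * (\<Prod>j\<in>{k..<m}. rahman_den Q a w c e f j))"

text \<open>Serves two homomorphisms: evaluation, which specialises an identity proved for an
  indeterminate parameter, and the embedding of a domain into its fraction field.\<close>

lemma (in unital_ring_hom) hom_rahman_sum:
  "h (rahman_sum Q a w c e f m) = rahman_sum (h Q) (h a) (h w) (h c) (h e) (h f) m"
  unfolding rahman_sum_def rahman_num_def rahman_den_def rahman_quad_def by (simp only: hom_simps)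

lemmas poly_rahman_sum = unital_ring_hom.hom_rahman_sum[OF unital_ring_hom_poly]

text \<open>
  The certificate of the WZ pair, with \<open>x = Q\<^sup>M\<close> and \<open>y = Q\<^sup>k\<close>, after removal of common factors.
\<close>

lemma rahman_certificate:
  fixes Q a w c x y :: "'a::comm_ring_1"
  shows "(1 - a*Q^3*y^3) * ((c*(1+a\<^sup>2*x^4*Q^3) - w*a*x\<^sup>2*Q) * y\<^sup>2*(x\<^sup>2*Q\<^sup>2-1)
            - c*(x\<^sup>2-y\<^sup>2)*(1-a*x\<^sup>2*Q\<^sup>2*y)*(1-a*x\<^sup>2*Q^3*y))
    = (x\<^sup>2-y\<^sup>2)*(1-a*Q*y)*a*Q\<^sup>2*y*(c*(1+Q^3*y\<^sup>2)-w*Q*y)*x\<^sup>2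
      - x\<^sup>2*(1-Q\<^sup>2*y\<^sup>2)*(c*(1+a\<^sup>2*y^4*Q^3) - w*a*Q*y\<^sup>2)*(1-a*x\<^sup>2*Q^3*y)"
  by (simp add: algebra_simps power2_eq_square power3_eq_cube power4_eq_xxxx)

text \<open>Here \<open>e = x\<^sup>2\<close> and \<open>f = 1\<close>, so
  \<open>d = x^(-2)\<close>. This is the \<open>k\<close>-th summand divided by all the
  \<open>rahman_den\<close> factors and by \<open>1 - a * Q^(3*k)\<close>.\<close>

definition rahman_ratio :: "'a::field \<Rightarrow> 'a \<Rightarrow> 'a \<Rightarrow> 'a \<Rightarrow> 'a \<Rightarrow> nat \<Rightarrow> 'a" where
  "rahman_ratio Q a w c x k = (\<Prod>j<k. rahman_num Q a w c (x\<^sup>2) 1 j / rahman_den Q a w c (x\<^sup>2) 1 j)"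

lemma rahman_ratio_Suc:
  "rahman_ratio Q a w c x (Suc k) = rahman_ratio Q a w c x k *
     ((1 - a * Q^k) * (a * Q * Q^k) * (c * (1 + Q * (Q^k)\<^sup>2) - w * Q^k) * (x\<^sup>2 - (Q^k)\<^sup>2)) /
     ((1 - Q\<^sup>2 * (Q^k)\<^sup>2) * rahman_quad Q a w c k * (1 - a * x\<^sup>2 * Q * Q^k))"
proof -
  have y: "Q ^ (2 * k) = (Q^k)\<^sup>2" by (simp add: power_mult power2_eq_square power_mult_distrib)
  have "rahman_num Q a w c (x\<^sup>2) 1 k =
    (1 - a * Q^k) * (a * Q * Q^k) * (c * (1 + Q * (Q^k)\<^sup>2) - w * Q^k) * (x\<^sup>2 - (Q^k)\<^sup>2)"
    unfolding rahman_num_def by (simp add: y mult.assoc)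
  moreover have "rahman_den Q a w c (x\<^sup>2) 1 k =
    (1 - Q\<^sup>2 * (Q^k)\<^sup>2) * rahman_quad Q a w c k * (1 - a * x\<^sup>2 * Q * Q^k)"
    unfolding rahman_den_def by (simp add: y mult.assoc power2_eq_square)
  ultimately show ?thesis unfolding rahman_ratio_def by simp
qed

lemma rahman_quad_alt:
  "rahman_quad Q a w c k = c * (1 + a\<^sup>2 * (Q^k)^4 * Q^3) - w * a * Q * (Q^k)\<^sup>2"
  unfolding rahman_quad_def by (simp add: power_add power_mult[symmetric] mult.commute mult.left_commute)

context
  fixes Q a w c :: "'a::field"
  assumes Q0: "Q \<noteq> 0" and Q1: "\<And>i. i > 0 \<Longrightarrow> Q ^ i \<noteq> 1" and aQ: "\<And>i. a * Q ^ i \<noteq> 1"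
    and quad: "\<And>j. rahman_quad Q a w c j \<noteq> 0"
begin

lemma rahman_factor_nonzero: assumes "x = Q ^ M" shows "1 - a * x\<^sup>2 * Q * Q^k \<noteq> 0" "1 - a * x\<^sup>2 * Q\<^sup>2 * Q^k \<noteq> 0"
   "1 - a * x\<^sup>2 * Q^3 * Q^k \<noteq> 0" "1 - a * x\<^sup>2 * Q^4 * Q^k \<noteq> 0"
  using aQ[of "2*M+1+k"] aQ[of "2*M+2+k"] aQ[of "2*M+3+k"] aQ[of "2*M+4+k"] unfolding assms
  by (auto simp: power_add power_mult[symmetric] mult_ac numeral_eq_Suc)

lemma one_minus_Q_power_nonzero: "1 - Q\<^sup>2 * (Q^k)\<^sup>2 \<noteq> 0"
proof -
  have "Q\<^sup>2 * (Q^k)\<^sup>2 = Q ^ (2 + 2 * k)"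
    by (simp add: power_add power_mult power_mult_distrib power2_eq_square)
  with Q1[of "2+2*k"] show ?thesis by simp
qed

text \<open>As \<open>(x*Q)\<^sup>2 - Q^(2*j+2) = Q\<^sup>2 * (x\<^sup>2 - Q^(2*j))\<close>, the
  numerator factors at \<open>x * Q\<close> are those at \<open>x\<close> moved by one place. Of the
  factors \<open>1 - a*x\<^sup>2*Q^i\<close> only two at the lower end and three at the upper end
  survive.\<close>

lemma rahman_ratio_shift:
  assumes x: "x = Q ^ M"
  shows "rahman_ratio Q a w c (x * Q) (Suc k) = rahman_ratio Q a w c x k *
     ((1 - a * Q^k) * (a * Q * Q^k) * (c * (1 + Q * (Q^k)\<^sup>2) - w * Q^k) * (Q^k)\<^sup>2 * (x\<^sup>2 * Q\<^sup>2 - 1)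
       * (1 - a * x\<^sup>2 * Q) * (1 - a * x\<^sup>2 * Q\<^sup>2)) /
     ((1 - Q\<^sup>2 * (Q^k)\<^sup>2) * rahman_quad Q a w c k * (1 - a * x\<^sup>2 * Q * Q^k)
       * (1 - a * x\<^sup>2 * Q\<^sup>2 * Q^k) * (1 - a * x\<^sup>2 * Q^3 * Q^k))"
proof (induction k)
  case 0
  have "1 - a * x\<^sup>2 * Q \<noteq> 0" "1 - a * x\<^sup>2 * Q\<^sup>2 \<noteq> 0"
    using rahman_factor_nonzero[OF x, of 0] by simp_all
  moreover have "a * (x * Q)\<^sup>2 * Q = a * x\<^sup>2 * Q ^ 3"
    by (simp add: power2_eq_square power3_eq_cube mult_ac)
  ultimately show ?case
    unfolding rahman_ratio_Suc by (simp add: rahman_ratio_def power_mult_distrib mult_ac)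
next
  case (Suc k)
  define y where "y = Q ^ k"
  have y': "Q ^ Suc k = Q * y" by (simp add: y_def)
  have nz: "1 - a * x\<^sup>2 * Q * y \<noteq> 0" "1 - a * x\<^sup>2 * Q\<^sup>2 * y \<noteq> 0"
    "1 - a * x\<^sup>2 * Q^3 * y \<noteq> 0" "1 - a * x\<^sup>2 * Q^4 * y \<noteq> 0" "1 - Q\<^sup>2 * y\<^sup>2 \<noteq> 0"
    using rahman_factor_nonzero[OF x, of k] one_minus_Q_power_nonzero[of k] by (simp_all add: y_def)
  have r: "(x * Q)\<^sup>2 - (Q * y)\<^sup>2 = Q\<^sup>2 * (x\<^sup>2 - y\<^sup>2)" "(Q * y)\<^sup>2 = Q\<^sup>2 * y\<^sup>2"
    "a * (x * Q)\<^sup>2 * Q * (Q * y) = a * x\<^sup>2 * Q^4 * y"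
    "a * x\<^sup>2 * Q\<^sup>2 * (Q * y) = a * x\<^sup>2 * Q^3 * y"
    "a * x\<^sup>2 * Q^3 * (Q * y) = a * x\<^sup>2 * Q^4 * y"
    "a * x\<^sup>2 * Q * (Q * y) = a * x\<^sup>2 * Q\<^sup>2 * y"
    by (simp_all add: algebra_simps power2_eq_square numeral_eq_Suc)
  have "rahman_ratio Q a w c (x * Q) (Suc (Suc k)) = rahman_ratio Q a w c (x * Q) (Suc k) * 
     ((1 - a * (Q*y)) * (a * Q * (Q*y)) * (c * (1 + Q * (Q*y)\<^sup>2) - w * (Q*y)) * (Q\<^sup>2 * (x\<^sup>2 - y\<^sup>2))) /
     ((1 - Q\<^sup>2 * (Q*y)\<^sup>2) * rahman_quad Q a w c (Suc k) * (1 - a * x\<^sup>2 * Q^4 * y))"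
    unfolding rahman_ratio_Suc[of _ _ _ _ _ "Suc k"] y' r(1,3) by simp
  also have "\<dots> = rahman_ratio Q a w c x (Suc k) *
     ((1 - a * (Q*y)) * (a * Q * (Q*y)) * (c * (1 + Q * (Q*y)\<^sup>2) - w * (Q*y)) * (Q*y)\<^sup>2 * (x\<^sup>2 * Q\<^sup>2 - 1)
       * (1 - a * x\<^sup>2 * Q) * (1 - a * x\<^sup>2 * Q\<^sup>2)) /
     ((1 - Q\<^sup>2 * (Q*y)\<^sup>2) * rahman_quad Q a w c (Suc k) * (1 - a * x\<^sup>2 * Q\<^sup>2 * y)
       * (1 - a * x\<^sup>2 * Q^3 * y) * (1 - a * x\<^sup>2 * Q^4 * y))"
    unfolding Suc.IH rahman_ratio_Suc[of _ _ _ _ x k] y_def[symmetric] r(2)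
    by (simp add: mult_ac)
  finally show ?case unfolding y' r(4-6) .
qed

text \<open>The WZ relation: the combination of the summands for \<open>M + 1\<close> and
  \<open>M\<close> is a difference in \<open>k\<close> of the right-hand side, and
  \<open>rahman_certificate\<close> is this fact with common factors removed.\<close>

lemma rahman_telescope:
  assumes x: "x = Q ^ M"
  shows "(\<Sum>i\<le>k. rahman_quad Q a w c M * (rahman_ratio Q a w c (x * Q) i * (1 - a * Q^(3*i)))
            - c * (1 - a * x\<^sup>2 * Q) * (1 - a * x\<^sup>2 * Q\<^sup>2) * (rahman_ratio Q a w c x i * (1 - a * Q^(3*i))))
     = (1 - a * x\<^sup>2 * Q) * (1 - a * x\<^sup>2 * Q\<^sup>2) * rahman_ratio Q a w c x k
        * ((1 - a * Q^k) * (a * Q * Q^k) * (c * (1 + Q * (Q^k)\<^sup>2) - w * Q^k) * x\<^sup>2)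
        / ((1 - a * x\<^sup>2 * Q * Q^k) * (1 - a * x\<^sup>2 * Q\<^sup>2 * Q^k))"
proof (induction k)
  case 0
  have "1 - a * x\<^sup>2 * Q \<noteq> 0" "1 - a * x\<^sup>2 * Q\<^sup>2 \<noteq> 0"
    using rahman_factor_nonzero[OF x, of 0] by simp_all
  moreover have "rahman_quad Q a w c M - c * (1 - a * x\<^sup>2 * Q) * (1 - a * x\<^sup>2 * Q\<^sup>2) = a * Q * (c * (1 + Q) - w) * x\<^sup>2"
    unfolding rahman_quad_alt x[symmetric]
    by (simp add: algebra_simps power2_eq_square power3_eq_cube power4_eq_xxxx)
  moreover from this have "rahman_quad Q a w c M * (1 - a) - c * (1 - a * x\<^sup>2 * Q) * (1 - a * x\<^sup>2 * Q\<^sup>2) * (1 - a)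
      = (1 - a) * (a * Q * (c * (1 + Q) - w) * x\<^sup>2)"
    unfolding left_diff_distrib[symmetric] by (simp add: mult.commute)
  ultimately show ?case
    by (simp add: rahman_ratio_def)
next
  case (Suc k)
  define y where "y = Q ^ k"
  define G where "G = rahman_quad Q a w c M"
  define g where "g = rahman_quad Q a w c k"
  define U where "U = rahman_ratio Q a w c x k"
  define E1 where "E1 = 1 - a * x\<^sup>2 * Q"
  define E2 where "E2 = 1 - a * x\<^sup>2 * Q\<^sup>2"
  define D where "D = 1 - Q\<^sup>2 * y\<^sup>2"
  define F1 where "F1 = 1 - a * x\<^sup>2 * Q * y"
  define F2 where "F2 = 1 - a * x\<^sup>2 * Q\<^sup>2 * y"
  define F3 where "F3 = 1 - a * x\<^sup>2 * Q^3 * y"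
  define K where "K = (1 - a * y) * (a * Q * y) * (c * (1 + Q * y\<^sup>2) - w * y)"
  define L where "L = (1 - a * Q * y) * a * Q\<^sup>2 * y * (c * (1 + Q^3 * y\<^sup>2) - w * Q * y)"
  have y': "Q ^ Suc k = Q * y" by (simp add: y_def)
  have nz: "F1 \<noteq> 0" "F2 \<noteq> 0" "F3 \<noteq> 0" "D \<noteq> 0" "g \<noteq> 0"
    using rahman_factor_nonzero[OF x, of k] one_minus_Q_power_nonzero[of k] quad[of k] by (simp_all add: y_def F1_def F2_def F3_def D_def g_def)
  have U1: "rahman_ratio Q a w c x (Suc k) = U * K * (x\<^sup>2 - y\<^sup>2) / (D * g * F1)"
    unfolding rahman_ratio_Suc y_def[symmetric] U_def K_def D_def g_def F1_def by (simp add: mult_ac)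
  have U2: "rahman_ratio Q a w c (x * Q) (Suc k) = U * K * (y\<^sup>2 * (x\<^sup>2*Q\<^sup>2-1)) * E1 * E2 / (D * g * F1 * F2 * F3)"
    unfolding rahman_ratio_shift[OF x] y_def[symmetric] U_def K_def D_def g_def F1_def F2_def F3_def E1_def E2_def
    by (simp add: mult_ac)
  have a3: "a * Q ^ (3 * Suc k) = a * Q^3 * y^3"
    by (simp add: y_def power_add power_mult[symmetric] mult.commute)
  have G: "G = c*(1+a\<^sup>2*x^4*Q^3) - w*a*x\<^sup>2*Q" and g: "g = c*(1+a\<^sup>2*y^4*Q^3) - w*a*Q*y\<^sup>2"
    unfolding G_def g_def rahman_quad_alt x y_def by (simp_all add: mult_ac)
  have L: "L = (1 - a * (Q*y)) * (a * Q * (Q*y)) * (c * (1 + Q * (Q*y)\<^sup>2) - w * (Q*y))"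
    unfolding L_def by (simp add: power2_eq_square power3_eq_cube mult_ac)
  have st: "(1 - a*Q^3*y^3) * (G * (y\<^sup>2*(x\<^sup>2*Q\<^sup>2-1)) - c*(x\<^sup>2-y\<^sup>2)*F2*F3)
     = (x\<^sup>2-y\<^sup>2)*L*x\<^sup>2 - x\<^sup>2*D*g*F3"
    using rahman_certificate[of a Q y c x w] unfolding G g D_def F2_def F3_def L_def by (simp only: mult.assoc)
  have "G * (rahman_ratio Q a w c (x * Q) (Suc k) * (1 - a * Q^(3*Suc k)))
            - c * E1 * E2 * (rahman_ratio Q a w c x (Suc k) * (1 - a * Q^(3*Suc k)))
     = U * K * E1 * E2 / (D * g * F1 * F2 * F3) * ((1 - a*Q^3*y^3) * (G * (y\<^sup>2*(x\<^sup>2*Q\<^sup>2-1)) - c*(x\<^sup>2-y\<^sup>2)*F2*F3))"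
    unfolding a3 U1 U2 using nz by (simp add: field_simps)
  also have "\<dots> = U * K * E1 * E2 / (D * g * F1 * F2 * F3) * ((x\<^sup>2-y\<^sup>2)*L*x\<^sup>2 - x\<^sup>2*D*g*F3)"
    unfolding st ..
  also have "\<dots> = E1 * E2 * rahman_ratio Q a w c x (Suc k) * (L * x\<^sup>2) / (F2 * F3)
     - E1 * E2 * U * (K * x\<^sup>2) / (F1 * F2)"
    unfolding U1 using nz by (simp add: field_simps)
  \<comment> \<open>The increment of the partial sum is the right-hand side of the claim at
    \<open>Suc k\<close> minus that at \<open>k\<close>.\<close>
  finally have inc: "G * (rahman_ratio Q a w c (x * Q) (Suc k) * (1 - a * Q^(3*Suc k)))
            - c * E1 * E2 * (rahman_ratio Q a w c x (Suc k) * (1 - a * Q^(3*Suc k)))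
     = E1 * E2 * rahman_ratio Q a w c x (Suc k) * (L * x\<^sup>2) / (F2 * F3)
     - E1 * E2 * U * (K * x\<^sup>2) / (F1 * F2)" .
  have F: "1 - a * x\<^sup>2 * Q * (Q * y) = F2" "1 - a * x\<^sup>2 * Q\<^sup>2 * (Q * y) = F3"
    unfolding F2_def F3_def by (simp_all add: power2_eq_square power3_eq_cube mult_ac)
  show ?case
    unfolding sum.atMost_Suc Suc.IH y' F L[symmetric] y_def[symmetric]
    using inc unfolding G_def E1_def E2_def U_def K_def F1_def F2_def
    by simp
qed

lemma rahman_ratio_eq_0: "M < k \<Longrightarrow> rahman_ratio Q a w c (Q ^ M) k = 0"
  unfolding rahman_ratio_def
  by (rule prod_zero) (auto intro!: bexI[of _ M] simp: rahman_num_def power_mult[symmetric] mult.commute)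

text \<open>At \<open>k = Suc M\<close> the right-hand side of \<open>rahman_telescope\<close>
  contains \<open>rahman_ratio Q a w c (Q ^ M) (Suc M) = 0\<close>, which leaves a first-order
  recurrence in \<open>M\<close>.\<close>

lemma rahman_ratio_sum_Suc:
  "rahman_quad Q a w c M * (\<Sum>i\<le>Suc M. rahman_ratio Q a w c (Q ^ Suc M) i * (1 - a * Q^(3*i)))
   = c * (1 - a * Q^(2*M+1)) * (1 - a * Q^(2*M+2)) * (\<Sum>i\<le>M. rahman_ratio Q a w c (Q ^ M) i * (1 - a * Q^(3*i)))"
proof -
  have x: "a * (Q^M)\<^sup>2 * Q = a * Q^(2*M+1)" "a * (Q^M)\<^sup>2 * Q\<^sup>2 = a * Q^(2*M+2)" "Q ^ M * Q = Q ^ Suc M"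
    by (simp_all add: power_mult[symmetric] power_add mult.commute mult.left_commute) (simp add: power2_eq_square)
  have "rahman_quad Q a w c M * (\<Sum>i\<le>Suc M. rahman_ratio Q a w c (Q ^ M * Q) i * (1 - a * Q^(3*i)))
   - c * (1 - a * (Q^M)\<^sup>2 * Q) * (1 - a * (Q^M)\<^sup>2 * Q\<^sup>2) * (\<Sum>i\<le>Suc M. rahman_ratio Q a w c (Q ^ M) i * (1 - a * Q^(3*i))) = 0"
    using rahman_telescope[OF refl, of M "Suc M"] rahman_ratio_eq_0[of M "Suc M"]
    by (simp only: sum_subtractf sum_distrib_left) simp
  thus ?thesis using rahman_ratio_eq_0[of M "Suc M"]
    unfolding x by simp
qed

lemma rahman_ratio_sum:
  "(\<Sum>i\<le>M. rahman_ratio Q a w c (Q ^ M) i * (1 - a * Q^(3*i))) * (\<Prod>j<M. rahman_quad Q a w c j)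
   = c ^ M * (\<Prod>j<2*M+1. 1 - a * Q^j)"
proof (induction M)
  case 0
  show ?case by (simp add: rahman_ratio_def)
next
  case (Suc M)
  have "(\<Sum>i\<le>Suc M. rahman_ratio Q a w c (Q ^ Suc M) i * (1 - a * Q^(3*i))) * (\<Prod>j<Suc M. rahman_quad Q a w c j)
    = (rahman_quad Q a w c M * (\<Sum>i\<le>Suc M. rahman_ratio Q a w c (Q ^ Suc M) i * (1 - a * Q^(3*i))))
      * (\<Prod>j<M. rahman_quad Q a w c j)"
    by (simp only: prod.lessThan_Suc mult_ac)
  also have "\<dots> = c * (1 - a * Q^(2*M+1)) * (1 - a * Q^(2*M+2)) * (c ^ M * (\<Prod>j<2*M+1. 1 - a * Q^j))"
    unfolding rahman_ratio_sum_Suc Suc.IH[symmetric] by (simp only: mult_ac)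
  also have "\<dots> = c ^ Suc M * (\<Prod>j<2*Suc M+1. 1 - a * Q^j)"
    by (simp add: mult_ac)
  finally show ?case .
qed

end

text \<open>The value of the sum at \<open>e = f * Q^(2*M)\<close>: the evaluation in
  \<open>rahman_ratio_sum\<close> times all denominator factors. The quadratic factors with
  \<open>j < M\<close> have cancelled.\<close>

definition rahman_prod :: "'a::comm_ring_1 \<Rightarrow> 'a \<Rightarrow> 'a \<Rightarrow> 'a \<Rightarrow> 'a \<Rightarrow> nat \<Rightarrow> nat \<Rightarrow> 'a" where
  "rahman_prod Q a w c f M m =
     f ^ m * c ^ M * (\<Prod>j<2*M+1. 1 - a * Q^j) * (\<Prod>j<m. 1 - Q^(2*j+2))
       * (\<Prod>j\<in>{M..<m}. rahman_quad Q a w c j) * (\<Prod>j<m. 1 - a * Q^(2*M+1+j))"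

lemma (in unital_ring_hom) hom_rahman_prod:
  "h (rahman_prod Q a w c f M m) = rahman_prod (h Q) (h a) (h w) (h c) (h f) M m"
  unfolding rahman_prod_def rahman_quad_def by (simp only: hom_simps)

lemmas poly_rahman_prod = unital_ring_hom.hom_rahman_prod[OF unital_ring_hom_poly]

lemma rahman_sum_terminating_field:
  fixes Q a w c f :: "'a::field"
  assumes Q0: "Q \<noteq> 0" and Q1: "\<And>i. i > 0 \<Longrightarrow> Q ^ i \<noteq> 1" and aQ: "\<And>i. a * Q ^ i \<noteq> 1"
    and quad: "\<And>j. rahman_quad Q a w c j \<noteq> 0" and f: "f \<noteq> 0" and M: "M \<le> m"
  shows "rahman_sum Q a w c (f * Q ^ (2 * M)) f m = rahman_prod Q a w c f M m"
proof -
  define x where "x = Q ^ M"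
  have x2: "x\<^sup>2 = Q ^ (2 * M)" by (simp add: x_def power_mult[symmetric] mult.commute)
  define u where "u = rahman_num Q a w c (x\<^sup>2) 1"
  define v where "v = rahman_den Q a w c (x\<^sup>2) 1"
  have u: "rahman_num Q a w c (f * Q ^ (2 * M)) f j = f * u j" for j
    unfolding u_def rahman_num_def x2 by (simp add: algebra_simps)
  have v: "rahman_den Q a w c (f * Q ^ (2 * M)) f j = f * v j" for j
    unfolding v_def rahman_den_def x2 by (simp add: algebra_simps)
  have veq: "v j = (1 - Q^(2*j+2)) * rahman_quad Q a w c j * (1 - a * Q^(2*M+1+j))" for j
    unfolding v_def rahman_den_def x2 by (simp add: power_add mult_ac)
  have v0: "v j \<noteq> 0" for j
    unfolding veq using Q1[of "2*j+2"] aQ[of "2*M+1+j"] quad[of j] by auto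
  \<comment> \<open>Every factor carries one \<open>f\<close> at this \<open>e\<close>, hence each
    summand carries \<open>f ^ m\<close>.\<close>
  have tm: "(1 - a * Q ^ (3 * k)) * (\<Prod>j<k. f * u j) * (\<Prod>j\<in>{k..<m}. f * v j)
     = f ^ m * (\<Prod>j<m. v j) * (rahman_ratio Q a w c x k * (1 - a * Q^(3*k)))" if "k \<le> m" for k
  proof -
    have "(\<Prod>j<m. v j) = (\<Prod>j<k. v j) * (\<Prod>j\<in>{k..<m}. v j)"
      using that by (metis atLeast0LessThan prod.atLeastLessThan_concat zero_le)
    moreover have "f ^ m = f ^ k * f ^ (m - k)"
      using that by (simp add: power_add[symmetric])
    moreover have "(\<Prod>j<k. v j) \<noteq> 0" using v0 by simp
    ultimately show ?thesis
      unfolding rahman_ratio_def u_def[symmetric] v_def[symmetric]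
      by (simp add: prod.distrib prod_dividef field_simps)
  qed
  have "rahman_sum Q a w c (f * Q ^ (2 * M)) f m
     = f ^ m * (\<Prod>j<m. v j) * (\<Sum>k\<le>m. rahman_ratio Q a w c x k * (1 - a * Q^(3*k)))"
    unfolding rahman_sum_def u v sum_distrib_left by (intro sum.cong refl tm) simp
  also have "(\<Sum>k\<le>m. rahman_ratio Q a w c x k * (1 - a * Q^(3*k)))
     = (\<Sum>k\<le>M. rahman_ratio Q a w c x k * (1 - a * Q^(3*k)))"
    using M rahman_ratio_eq_0[OF Q0 Q1 aQ quad]
    by (intro sum.mono_neutral_right) (auto simp: x_def)
  also have "(\<Prod>j<m. v j) = (\<Prod>j<m. 1 - Q^(2*j+2)) * ((\<Prod>j<M. rahman_quad Q a w c j) *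
      (\<Prod>j\<in>{M..<m}. rahman_quad Q a w c j)) * (\<Prod>j<m. 1 - a * Q^(2*M+1+j))"
    unfolding veq prod.distrib
    using M by (metis atLeast0LessThan prod.atLeastLessThan_concat zero_le)
  finally show ?thesis
    using rahman_ratio_sum[OF Q0 Q1 aQ quad, of M]
    unfolding rahman_prod_def x_def by (simp add: mult_ac)
qed

lemma rahman_sum_terminating_idom:
  fixes Q a w c f :: "'a::idom"
  assumes Q0: "Q \<noteq> 0" and Q1: "\<And>i. i > 0 \<Longrightarrow> Q ^ i \<noteq> 1" and aQ: "\<And>i. a * Q ^ i \<noteq> 1"
    and quad: "\<And>j. rahman_quad Q a w c j \<noteq> 0" and f: "f \<noteq> 0" and M: "M \<le> m"
  shows "rahman_sum Q a w c (f * Q ^ (2 * M)) f m = rahman_prod Q a w c f M m"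
proof -
  interpret unital_ring_hom "to_fract :: 'a \<Rightarrow> 'a fract" by (rule unital_ring_hom_to_fract)
  have "to_fract (rahman_quad Q a w c j) = rahman_quad (to_fract Q) (to_fract a) (to_fract w) (to_fract c) j" for j
    unfolding rahman_quad_def by (simp add: hom_power)
  with quad have quad': "rahman_quad (to_fract Q) (to_fract a) (to_fract w) (to_fract c) j \<noteq> 0" for j
    by (metis to_fract_eq_0_iff)
  have "to_fract (rahman_sum Q a w c (f * Q ^ (2 * M)) f m)
     = rahman_sum (to_fract Q) (to_fract a) (to_fract w) (to_fract c) (to_fract f * to_fract Q ^ (2 * M)) (to_fract f) m"
    by (simp only: hom_rahman_sum hom_mult hom_power)
  also have "\<dots> = rahman_prod (to_fract Q) (to_fract a) (to_fract w) (to_fract c) (to_fract f) M m"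
  proof (rule rahman_sum_terminating_field)
    show "to_fract Q ^ i \<noteq> 1" if "i > 0" for i
      using Q1[OF that] by (metis hom_power to_fract_1 to_fract_eq_iff)
    show "to_fract a * to_fract Q ^ i \<noteq> 1" for i
      using aQ[of i] by (metis hom_power to_fract_1 to_fract_eq_iff to_fract_mult)
  qed (use Q0 quad' f M in auto)
  also have "\<dots> = to_fract (rahman_prod Q a w c f M m)"
    by (simp only: hom_rahman_prod)
  finally show ?thesis by simp
qed

text \<open>With \<open>w\<close> an indeterminate, \<open>rahman_quad\<close> has the nonzero
  linear coefficient \<open>- a * Q^(2*j+1)\<close> and so cannot vanish. Afterwards
  \<open>w\<close> is specialised.\<close>

lemma rahman_sum_terminating_poly:
  fixes Q a c f :: "'a::idom"
  assumes Q0: "Q \<noteq> 0" and Q1: "\<And>i. i > 0 \<Longrightarrow> Q ^ i \<noteq> 1" and aQ: "\<And>i. a * Q ^ i \<noteq> 1"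
    and a: "a \<noteq> 0" and f: "f \<noteq> 0" and M: "M \<le> m"
  shows "rahman_sum [:Q:] [:a:] [:0, 1:] [:c:] ([:f:] * [:Q:] ^ (2 * M)) [:f:] m
    = rahman_prod [:Q:] [:a:] [:0, 1:] [:c:] [:f:] M m"
proof (rule rahman_sum_terminating_idom)
  show "[:Q:] ^ i \<noteq> 1" if "i > 0" for i using Q1[OF that] by (simp add: const_poly_power one_pCons)
  show "[:a:] * [:Q:] ^ i \<noteq> 1" for i using aQ[of i] by (simp add: const_poly_power one_pCons mult.commute)
  show "rahman_quad [:Q:] [:a:] [:0, 1:] [:c:] j \<noteq> 0" for j
  proof -
    have "coeff (rahman_quad [:Q:] [:a:] [:0, 1:] [:c:] j) 1 = - (a * Q ^ (2 * j + 1))"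
      unfolding rahman_quad_def by (simp add: const_poly_power one_pCons)
    thus ?thesis using a Q0 by (metis coeff_0 mult_eq_0_iff neg_equal_0_iff_equal power_not_zero)
  qed
qed (use Q0 f M in auto)

lemma rahman_sum_terminating_generic:
  fixes Q a w c f :: "'a::idom"
  assumes "Q \<noteq> 0" "\<And>i. i > 0 \<Longrightarrow> Q ^ i \<noteq> 1" "\<And>i. a * Q ^ i \<noteq> 1" "a \<noteq> 0" "f \<noteq> 0" "M \<le> m"
  shows "rahman_sum Q a w c (f * Q ^ (2 * M)) f m = rahman_prod Q a w c f M m"
proof -
  have "poly (rahman_sum [:Q:] [:a:] [:0, 1:] [:c:] ([:f:] * [:Q:] ^ (2 * M)) [:f:] m) w
    = rahman_sum Q a w c (f * Q ^ (2 * M)) f m"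
    by (simp add: poly_rahman_sum)
  moreover have "poly (rahman_prod [:Q:] [:a:] [:0, 1:] [:c:] [:f:] M m) w = rahman_prod Q a w c f M m"
    by (simp add: poly_rahman_prod)
  ultimately show ?thesis
    using rahman_sum_terminating_poly[OF assms] by simp
qed

subsection \<open>Vanishing by interpolation\<close>

lemma degree_prod_le_card:
  fixes g :: "'b \<Rightarrow> 'a::comm_semiring_1 poly"
  assumes "finite A" "\<And>j. degree (g j) \<le> 1"
  shows "degree (prod g A) \<le> card A"
proof -
  have "degree (prod g A) \<le> sum (degree \<circ> g) A" by (rule degree_prod_sum_le[OF assms(1)])
  also have "\<dots> \<le> (\<Sum>j\<in>A. 1)" by (rule sum_mono) (use assms in simp)
  finally show ?thesis by simp
qed

text \<open>The same device for \<open>a\<close>: an indeterminate is nonzero and never inverse to a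
  power of \<open>Q\<close>. Evaluation then reaches every \<open>a\<close>, including values at
  which denominators vanish.\<close>

lemma rahman_sum_terminating:
  fixes Q a w c f :: "'a::idom"
  assumes "Q \<noteq> 0" and Q1: "\<And>i. i > 0 \<Longrightarrow> Q ^ i \<noteq> 1" and "f \<noteq> 0" "M \<le> m"
  shows "rahman_sum Q a w c (f * Q ^ (2 * M)) f m = rahman_prod Q a w c f M m"
proof -
  have "rahman_sum [:Q:] [:0, 1:] [:w:] [:c:] ([:f:] * [:Q:] ^ (2 * M)) [:f:] m
    = rahman_prod [:Q:] [:0, 1:] [:w:] [:c:] [:f:] M m"
    by (rule rahman_sum_terminating_generic) (use assms in \<open>auto simp: const_poly_power one_pCons\<close>)
  hence "poly (rahman_sum [:Q:] [:0, 1:] [:w:] [:c:] ([:f:] * [:Q:] ^ (2 * M)) [:f:] m) a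
    = poly (rahman_prod [:Q:] [:0, 1:] [:w:] [:c:] [:f:] M m) a" by simp
  thus ?thesis
    by (simp add: poly_rahman_sum poly_rahman_prod)
qed

text \<open>The \<open>k\<close>-th summand has \<open>k\<close> factors \<open>rahman_num\<close>
  and \<open>m - k\<close> factors \<open>rahman_den\<close>, each of degree at most one in
  \<open>e\<close>. Both interpolations below rest on this bound.\<close>

lemma degree_rahman_sum_le:
  "degree (rahman_sum [:Q:] [:a:] [:w:] [:c:] [:0, 1:] [:f:] m) \<le> m"
proof -
  have u: "degree (rahman_num [:Q:] [:a:] [:w:] [:c:] [:0, 1:] [:f:] j) \<le> 1" for j
    unfolding rahman_num_def by (simp add: const_poly_power one_pCons degree_pCons_le del: degree_pCons_eq)
  have v: "degree (rahman_den [:Q:] [:a:] [:w:] [:c:] [:0, 1:] [:f:] j) \<le> 1" for j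
    unfolding rahman_den_def rahman_quad_def by (simp add: const_poly_power one_pCons)
  show ?thesis unfolding rahman_sum_def
  proof (intro degree_sum_le)
    fix k assume "k \<in> {..m}"
    hence k: "k \<le> m" by simp
    let ?U = "\<Prod>j<k. rahman_num [:Q:] [:a:] [:w:] [:c:] [:0, 1:] [:f:] j"
    let ?V = "\<Prod>j\<in>{k..<m}. rahman_den [:Q:] [:a:] [:w:] [:c:] [:0, 1:] [:f:] j"
    have "1 - [:a:] * [:Q:] ^ (3 * k) = [:1 - a * Q ^ (3 * k):]" by (simp add: const_poly_power one_pCons mult.commute)
    hence "degree ((1 - [:a:] * [:Q:] ^ (3 * k)) * ?U * ?V) \<le> degree (?U * ?V)"
      by (simp add: mult.assoc degree_smult_le)
    also have "\<dots> \<le> degree ?U + degree ?V" by (rule degree_mult_le)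
    also have "\<dots> \<le> card {..<k} + card {k..<m}" by (intro add_mono degree_prod_le_card u v) simp_all
    finally show "degree ((1 - [:a:] * [:Q:] ^ (3 * k)) * ?U * ?V) \<le> m" using k by simp
  qed simp
qed

lemma poly_rahman_sum_const:
  "poly (rahman_sum [:Q:] [:a:] [:w:] [:c:] [:0, 1:] [:f:] m) e = rahman_sum Q a w c e f m"
  by (simp add: poly_rahman_sum)

lemma poly_eq_0_if_many_roots:
  fixes p :: "'a::idom poly"
  assumes "degree p < card A" "\<And>x. x \<in> A \<Longrightarrow> poly p x = 0"
  shows "p = 0"
proof (rule ccontr)
  assume "p \<noteq> 0"
  hence "card {x. poly p x = 0} \<le> degree p" "finite {x. poly p x = 0}"
    by (simp_all add: card_poly_roots_bound poly_roots_finite)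
  moreover have "A \<subseteq> {x. poly p x = 0}" using assms(2) by auto
  ultimately show False using assms(1) by (meson card_mono leD le_trans)
qed

lemma power_inject_if_not_root_of_unity:
  fixes Q :: "'a::idom"
  assumes "Q \<noteq> 0" "\<And>i. i > 0 \<Longrightarrow> Q ^ i \<noteq> 1" "Q ^ i = Q ^ j"
  shows "i = j"
proof -
  have "\<not> i < j" if "Q ^ i = Q ^ j" for i j
  proof
    assume "i < j"
    hence "Q ^ j = Q ^ i * Q ^ (j - i)" by (simp add: power_add[symmetric])
    with that assms(1) have "Q ^ (j - i) = 1" by simp
    with assms(2)[of "j - i"] \<open>i < j\<close> show False by simp
  qed
  from this[of i j] this[of j i] assms(3) show ?thesis by force
qed

text \<open>A polynomial in \<open>e\<close> of degree at most \<open>m\<close> with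
  \<open>2 * (m - N) + 1 > m\<close> zeros: on \<open>A\<close> the closed form contains
  \<open>1 - a * Q^N = 0\<close>, and on \<open>B\<close> every single summand vanishes.\<close>

lemma rahman_sum_eq_0_if_terminates:
  fixes Q a w c e f :: "'a::field"
  assumes Q0: "Q \<noteq> 0" and Q1: "\<And>i. i > 0 \<Longrightarrow> Q ^ i \<noteq> 1" and f: "f \<noteq> 0"
    and aQ: "a * Q ^ N = 1" and m: "2 * N \<le> m"
  shows "rahman_sum Q a w c e f m = 0"
proof -
  define p where "p = rahman_sum [:Q:] [:a:] [:w:] [:c:] [:0, 1:] [:f:] m"
  define A where "A = (\<lambda>M. f * Q ^ (2 * M)) ` {N..m}"
  define B where "B = (\<lambda>i. f / Q ^ i) ` {1..m - N}"
  have inj: "i = j" if "Q ^ i = Q ^ j" for i j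
    using Q0 Q1 that by (rule power_inject_if_not_root_of_unity)
  have cA: "card A = m - N + 1"
  proof -
    have "inj_on (\<lambda>M. f * Q ^ (2 * M)) {N..m}"
    proof (rule inj_onI)
      fix x y assume "f * Q ^ (2 * x) = f * Q ^ (2 * y)"
      hence "Q ^ (2 * x) = Q ^ (2 * y)" using f by simp
      hence "2 * x = 2 * y" by (rule inj)
      thus "x = y" by simp
    qed
    thus ?thesis using m unfolding A_def by (simp add: card_image)
  qed
  have cB: "card B = m - N"
  proof -
    have "inj_on (\<lambda>i. f / Q ^ i) {1..m - N}" using f Q0 by (auto intro!: inj_onI intro: inj simp: field_simps)
    thus ?thesis unfolding B_def by (simp add: card_image)
  qed
  have "A \<inter> B = {}"
  proof -
    have "f * Q ^ (2 * M) \<noteq> f / Q ^ i" if "i \<ge> 1" for M i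
      using f Q0 Q1[of "2 * M + i"] that by (auto simp: field_simps power_add)
    thus ?thesis unfolding A_def B_def by fastforce
  qed
  hence "card (A \<union> B) = 2 * (m - N) + 1"
    using cA cB by (subst card_Un_disjoint) (auto simp: A_def B_def)
  moreover have "degree p \<le> m" unfolding p_def by (rule degree_rahman_sum_le)
  ultimately have "degree p < card (A \<union> B)" using m by linarith
  moreover have "poly p x = 0" if "x \<in> A \<union> B" for x
    using that
  proof
    assume "x \<in> A"
    then obtain M where M: "N \<le> M" "M \<le> m" and x: "x = f * Q ^ (2 * M)" by (auto simp: A_def)
    have "rahman_prod Q a w c f M m = 0"
    proof -
      have "(\<Prod>j<2*M+1. 1 - a * Q^j) = 0"
        by (rule prod_zero) (use M aQ in \<open>auto intro!: bexI[of _ N]\<close>)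
      thus ?thesis unfolding rahman_prod_def by simp
    qed
    thus ?thesis using rahman_sum_terminating[OF Q0 Q1 f M(2), of a w c]
      by (simp add: p_def poly_rahman_sum_const x)
  next
    assume "x \<in> B"
    then obtain i where i: "1 \<le> i" "i \<le> m - N" and x: "x = f / Q ^ i" by (auto simp: B_def)
    \<comment> \<open>At \<open>e = f / Q^i\<close> the denominator factor of index
      \<open>N + i - 1\<close> is zero, which removes the summands with \<open>k \<le> N\<close>;
      the others contain the numerator factor of index \<open>N\<close>, zero because
      \<open>a * Q^N = 1\<close>.\<close>
    have "(1 - a * Q ^ (3 * k)) * (\<Prod>j<k. rahman_num Q a w c x f j) * (\<Prod>j\<in>{k..<m}. rahman_den Q a w c x f j) = 0"
      if "k \<le> m" for k
    proof (cases "k \<le> N")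
      case True
      have "a * x * Q ^ (N + i - 1 + 1) = (a * Q ^ N) * f * (Q ^ i / Q ^ i)"
        unfolding x using i by (simp add: power_add)
      also have "\<dots> = f" using aQ Q0 by simp
      finally have "rahman_den Q a w c x f (N + i - 1) = 0" unfolding rahman_den_def by simp
      hence "(\<Prod>j\<in>{k..<m}. rahman_den Q a w c x f j) = 0"
        by (intro prod_zero) (use True i m in \<open>auto intro!: bexI[of _ "N + i - 1"]\<close>)
      thus ?thesis by simp
    next
      case False
      have "rahman_num Q a w c x f N = 0" unfolding rahman_num_def using aQ by simp
      hence "(\<Prod>j<k. rahman_num Q a w c x f j) = 0"
        by (intro prod_zero) (use False in \<open>auto intro!: bexI[of _ N]\<close>)
      thus ?thesis by simp
    qed
    hence "rahman_sum Q a w c x f m = 0" unfolding rahman_sum_def by (intro sum.neutral) auto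
    thus ?thesis unfolding p_def poly_rahman_sum_const .
  qed
  ultimately have "p = 0" by (rule poly_eq_0_if_many_roots)
  thus ?thesis using poly_rahman_sum_const[of Q a w c f m e] by (simp add: p_def)
qed

text \<open>For \<open>n = 2*N+1\<close> one has \<open>z = z^(1-n) = (z\<^sup>2)^(-N)\<close>, the
  terminating case. Because \<open>z\<^sup>2\<close> is itself a root of unity, that case is reached
  only by continuity.\<close>

lemma rahman_sum_root_of_unity:
  fixes z w c e f :: complex
  assumes z: "z ^ n = 1" and n: "odd n" and f: "f \<noteq> 0"
  shows "rahman_sum (z\<^sup>2) z w c e f (n - 1) = 0"
proof -
  obtain N where N: "n = 2 * N + 1" using n by (elim oddE)
  have z1: "norm z = 1" using power_eq_1_iff[OF z] N by simp
  hence z0: "z \<noteq> 0" by auto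
  \<comment> \<open>Radial approach from inside the unit disc, where no positive power of
    \<open>(r k)\<^sup>2\<close> is \<open>1\<close>.\<close>
  define r where "r k = complex_of_real (1 - inverse (real (Suc (Suc k)))) * z" for k
  have "(\<lambda>k. 1 - inverse (real (Suc (Suc k)))) \<longlonglongrightarrow> 1 - 0"
    by (intro tendsto_diff tendsto_const LIMSEQ_Suc[OF LIMSEQ_inverse_real_of_nat])
  from tendsto_mult[OF tendsto_of_real[OF this] tendsto_const[of z]]
  have r: "r \<longlonglongrightarrow> z" unfolding r_def by simp
  \<comment> \<open>For \<open>\<bar>q\<bar> < 1\<close> the value \<open>a = q\<^bsup>1-n\<^esup>\<close> terminates the sum; in the limit \<open>q \<rightarrow> z\<close> it becomes \<open>z\<close>.\<close>
  define h where "h q = rahman_sum (q\<^sup>2) (inverse q ^ (2 * N)) w c e f (n - 1)" for q :: complex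
  have h0: "h (r k) = 0" for k
  proof -
    have r0: "0 < norm (r k)" and r1: "norm (r k) < 1"
    proof -
      have "inverse (real (Suc (Suc k))) < 1" "inverse (real (Suc (Suc k))) > 0" by (simp_all add: field_simps)
      thus "0 < norm (r k)" "norm (r k) < 1" unfolding r_def norm_mult z1 norm_of_real by simp_all
    qed
    show ?thesis unfolding h_def
    proof (rule rahman_sum_eq_0_if_terminates)
      show "(r k)\<^sup>2 \<noteq> 0" using r0 by auto
      show "((r k)\<^sup>2) ^ i \<noteq> 1" if "i > 0" for i
      proof
        assume "((r k)\<^sup>2) ^ i = 1"
        hence "norm (r k) ^ (2 * i) = 1" by (metis norm_one norm_power power_mult)
        moreover have "norm (r k) ^ (2 * i) < 1" using power_strict_decreasing[of 0 "2 * i" "norm (r k)"] r0 r1 that by simp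
        ultimately show False by simp
      qed
      show "inverse (r k) ^ (2 * N) * ((r k)\<^sup>2) ^ N = 1"
        using r0 by (simp add: power_mult[symmetric] power_mult_distrib[symmetric])
    qed (use f N in auto)
  qed
  have "isCont h z"
    unfolding h_def rahman_sum_def rahman_num_def rahman_den_def rahman_quad_def
    by (intro continuous_intros z0)
  hence "(\<lambda>k. h (r k)) \<longlonglongrightarrow> h z" using r by (rule isCont_tendsto_compose)
  hence "h z = 0" unfolding h0 by (simp add: LIMSEQ_const_iff)
  moreover have "inverse z ^ (2 * N) = z"
  proof -
    have "z * z ^ (2 * N) = 1" using z N by simp
    thus ?thesis using z0 by (simp add: field_simps)
  qed
  ultimately show ?thesis unfolding h_def by simp
qed

text \<open>These \<open>w\<close> and \<open>c\<close> mean \<open>b = Q^(-N)\<close>. Up to a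
  factor independent of \<open>M\<close>, the closed form is then the value at
  \<open>Q^(2*M)\<close> of a product of \<open>m\<close> explicit linear factors, as interpolation
  in \<open>e/f\<close> requires.\<close>

lemma rahman_prod_ratio:
  fixes Q a w c :: "'a::idom" and N :: nat
  defines "c \<equiv> Q ^ N" and "w \<equiv> 1 + Q ^ (2 * N + 1)"
  assumes aQ: "\<And>i. a * Q ^ i \<noteq> 1" and N: "\<And>j. Q ^ N \<noteq> a * Q ^ (2 * j + 1)" and M: "M \<le> m" and m: "N \<le> m"
  shows "rahman_prod Q a w c f M m * (\<Prod>i<N. Q ^ N - a * Q ^ (1 + 2 * i)) * (\<Prod>j\<in>{N..<m}. 1 - a * Q ^ (1 + j))
       = rahman_prod Q a w c f 0 m * (\<Prod>i<N. Q ^ N - a * Q ^ (2 * M + 1 + 2 * i)) * (\<Prod>j\<in>{N..<m}. 1 - a * Q ^ (2 * M + 1 + j))"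
proof -
  \<comment> \<open>\<open>X\<close> collects the factors depending on \<open>M\<close> other than
    \<open>Z\<close>; it obeys the same first-order recurrence in \<open>M\<close> as
    \<open>Y\<close>.\<close>
  define X where "X M = c ^ M * (\<Prod>j<2*M+1. 1 - a * Q^j) * (\<Prod>j\<in>{M..<m}. rahman_quad Q a w c j)
    * (\<Prod>j<N. 1 - a * Q^(2*M+1+j))" for M
  define Y where "Y M = (\<Prod>i<N. Q ^ N - a * Q ^ (2 * M + 1 + 2 * i))" for M
  define Z where "Z M = (\<Prod>j\<in>{N..<m}. 1 - a * Q ^ (2 * M + 1 + j))" for M
  have RX: "rahman_prod Q a w c f M m = f ^ m * (\<Prod>j<m. 1 - Q^(2*j+2)) * X M * Z M" for M
  proof -
    have "(\<Prod>j<m. 1 - a * Q^(2*M+1+j)) = (\<Prod>j<N. 1 - a * Q^(2*M+1+j)) * Z M"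
      unfolding Z_def using m by (metis atLeast0LessThan prod.atLeastLessThan_concat zero_le)
    thus ?thesis unfolding rahman_prod_def X_def by (simp add: mult_ac)
  qed
  \<comment> \<open>At \<open>b = Q^(-N)\<close> the quadratic factor splits into linear
    ones.\<close>
  have quad: "rahman_quad Q a w c j = (Q ^ N - a * Q ^ (2*j+1)) * (1 - a * Q ^ (2*j+2+N))" for j
    unfolding rahman_quad_def c_def w_def
    by (simp add: algebra_simps power2_eq_square power_add[symmetric] flip: power_Suc) (simp add: algebra_simps power_add numeral_eq_Suc)
  have shift: "(1 - u * Q) * (1 - u * Q^2) * (\<Prod>j<N. 1 - u * Q^(3+j))
      = (\<Prod>j<N. 1 - u * Q^(1+j)) * (1 - u * Q^(1+N)) * (1 - u * Q^(2+N))" for u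
    by (induction N) (simp_all add: mult_ac numeral_eq_Suc)
  have X: "X (Suc M) * (Q ^ N - a * Q ^ (2*M+1)) = X M * (Q ^ N * (1 - a * Q ^ (2*M+1+N)))" if "M < m" for M
  proof -
    define E where "E = (1 - a * Q ^ (2*M+1)) * (1 - a * Q ^ (2*M+2)) * (1 - a * Q ^ (2*M+2+N))"
    define P where "P = c ^ M * (\<Prod>j<2*M+1. 1 - a * Q^j) * (\<Prod>j\<in>{Suc M..<m}. rahman_quad Q a w c j)"
    define E1 where "E1 = (1 - a * Q ^ (2*M+1)) * (1 - a * Q ^ (2*M+2))"
    define P1 where "P1 = (\<Prod>j<N. 1 - a * Q^(2*Suc M+1+j))"
    define P0 where "P0 = (\<Prod>j<N. 1 - a * Q^(2*M+1+j))"
    define D where "D = Q ^ N - a * Q ^ (2*M+1)"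
    define F1 where "F1 = 1 - a * Q ^ (2*M+1+N)"
    define F2 where "F2 = 1 - a * Q ^ (2*M+2+N)"
    have E: "E = E1 * F2" unfolding E_def E1_def F2_def ..
    have "E \<noteq> 0" unfolding E_def using aQ[of "2*M+1"] aQ[of "2*M+2"] aQ[of "2*M+2+N"] by simp
    have s: "E1 * P1 = P0 * F1 * F2"
      using shift[of "a * Q^(2*M)"] unfolding E1_def P1_def P0_def F1_def F2_def
      by (simp add: power_add mult_ac numeral_eq_Suc)
    have X1: "X (Suc M) = c * E1 * P * P1"
      unfolding X_def P_def E1_def P1_def by (simp add: mult_ac)
    have "{M..<m} = insert M {Suc M..<m}" using that by auto
    hence X0: "X M = P * (D * F2) * P0"
      unfolding X_def P_def P0_def D_def F2_def by (simp add: quad mult_ac)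
    have "X (Suc M) * D * E = c * E1 * P * D * F2 * (E1 * P1)" unfolding X1 E by (simp add: mult_ac)
    also have "\<dots> = X M * (c * F1) * E" unfolding s X0 E by (simp add: mult_ac)
    finally show ?thesis using \<open>E \<noteq> 0\<close> unfolding D_def F1_def c_def by simp
  qed
  have Y: "Y (Suc M) * (Q ^ N - a * Q ^ (2*M+1)) = Y M * (Q ^ N * (1 - a * Q ^ (2*M+1+N)))" for M
  proof -
    have "(\<Prod>i<K. Q ^ N - u * Q ^ (3 + 2 * i)) * (Q ^ N - u * Q)
       = (\<Prod>i<K. Q ^ N - u * Q ^ (1 + 2 * i)) * (Q ^ N - u * Q ^ (1 + 2 * K))" for u K
      by (induction K) (simp_all add: mult_ac numeral_eq_Suc)
    from this[of "a * Q^(2*M)" N] show ?thesis unfolding Y_def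
      by (simp add: power_add mult_ac numeral_eq_Suc power_mult algebra_simps)
  qed
  have "X M * Y 0 = X 0 * Y M" using M
  proof (induction M)
    case (Suc M)
    define D where "D = Q ^ N - a * Q ^ (2*M+1)"
    have D: "D \<noteq> 0" using N[of M] by (simp add: D_def)
    have "X (Suc M) * Y 0 * D = (X M * Y 0) * (Q ^ N * (1 - a * Q ^ (2*M+1+N)))"
      using X[of M] Suc.prems unfolding D_def by (simp add: mult_ac)
    also have "\<dots> = X 0 * (Y M * (Q ^ N * (1 - a * Q ^ (2*M+1+N))))"
      using Suc by (simp add: mult_ac)
    also have "\<dots> = X 0 * Y (Suc M) * D" unfolding Y[symmetric] D_def by (simp add: mult_ac)
    finally show ?case using D by simp
  qed simp
  hence "f ^ m * (\<Prod>j<m. 1 - Q^(2*j+2)) * Z M * Z 0 * (X M * Y 0)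
      = f ^ m * (\<Prod>j<m. 1 - Q^(2*j+2)) * Z M * Z 0 * (X 0 * Y M)" by simp
  thus ?thesis unfolding RX by (simp add: Y_def Z_def mult_ac)
qed

text \<open>Here \<open>b = Q^(-N)\<close> and \<open>d = a\<close>. As a polynomial in
  \<open>e\<close> the sum is proportional to the product \<open>R\<close>, by interpolation at
  \<open>m + 1\<close> points, and \<open>R\<close> has a zero factor when \<open>f = a * e\<close>
  and \<open>N\<close> is odd.\<close>

lemma rahman_sum_eq_0_if_odd:
  fixes Q a e f :: "'a::idom"
  assumes Q0: "Q \<noteq> 0" and Q1: "\<And>i. i > 0 \<Longrightarrow> Q ^ i \<noteq> 1" and f0: "f \<noteq> 0" and f: "f = a * e"
    and aQ: "\<And>i. a * Q ^ i \<noteq> 1" and N: "\<And>j. Q ^ N \<noteq> a * Q ^ (2 * j + 1)" and oN: "odd N"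
  shows "rahman_sum Q a (1 + Q ^ (2 * N + 1)) (Q ^ N) e f (2 * N) = 0"
proof -
  define c where "c = Q ^ N"
  define w where "w = 1 + Q ^ (2 * N + 1)"
  define m where "m = 2 * N"
  define K where "K = (\<Prod>i<N. Q ^ N - a * Q ^ (1 + 2 * i)) * (\<Prod>j\<in>{N..<m}. 1 - a * Q ^ (1 + j))"
  \<comment> \<open>The factors from \<open>rahman_prod_ratio\<close> with \<open>Q^(2*M)\<close>
    replaced by \<open>e / f\<close>, multiplied through by \<open>f\<close>.\<close>
  define R where "R = (\<Prod>i<N. [:f * Q ^ N, - (a * Q ^ (1 + 2 * i)):]) * (\<Prod>j\<in>{N..<m}. [:f, - (a * Q ^ (1 + j)):])"
  have pR: "poly R x = (\<Prod>i<N. f * Q ^ N - a * x * Q ^ (1 + 2 * i)) * (\<Prod>j\<in>{N..<m}. f - a * x * Q ^ (1 + j))" for x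
    unfolding R_def by (simp add: poly_prod mult_ac)
  have dR: "degree R \<le> m"
  proof -
    have "degree R \<le> card {..<N} + card {N..<m}"
      unfolding R_def by (rule order.trans[OF degree_mult_le add_mono]; rule degree_prod_le_card) simp_all
    thus ?thesis by (simp add: m_def)
  qed
  define p where "p = smult K (rahman_sum [:Q:] [:a:] [:w:] [:c:] [:0, 1:] [:f:] m)
     - smult (rahman_prod Q a w c 1 0 m) R"
  have dp: "degree p \<le> m" unfolding p_def
    by (intro degree_diff_le order.trans[OF degree_smult_le] dR degree_rahman_sum_le)
  have "p = 0"
  proof (rule poly_eq_0_if_many_roots)
    have "inj_on (\<lambda>M. f * Q ^ (2 * M)) {0..m}"
    proof (rule inj_onI)
      fix x y assume "f * Q ^ (2 * x) = f * Q ^ (2 * y)"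
      hence "2 * x = 2 * y" by (intro power_inject_if_not_root_of_unity[OF Q0 Q1]) (use f0 in simp_all)
      thus "x = y" by simp
    qed
    thus "degree p < card ((\<lambda>M. f * Q ^ (2 * M)) ` {0..m})" using dp by (simp add: card_image)
    fix x assume "x \<in> (\<lambda>M. f * Q ^ (2 * M)) ` {0..m}"
    then obtain M where M: "M \<le> m" and x: "x = f * Q ^ (2 * M)" by auto
    have f1: "rahman_prod Q a w c f M m = f ^ m * rahman_prod Q a w c 1 M m" for M
      unfolding rahman_prod_def by (simp add: mult_ac)
    have "(\<Prod>i<N. f * Q ^ N - a * x * Q ^ (1 + 2 * i)) = (\<Prod>i<N. f * (Q ^ N - a * Q ^ (2 * M + 1 + 2 * i)))"
      by (intro prod.cong refl) (simp add: x algebra_simps power_add)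
    moreover have "(\<Prod>j\<in>{N..<m}. f - a * x * Q ^ (1 + j)) = (\<Prod>j\<in>{N..<m}. f * (1 - a * Q ^ (2 * M + 1 + j)))"
      by (intro prod.cong refl) (simp add: x algebra_simps power_add)
    moreover have "f ^ m = f ^ N * f ^ (m - N)" by (simp add: m_def mult_2 power_add)
    ultimately have "poly R x = f ^ m * ((\<Prod>i<N. Q ^ N - a * Q ^ (2 * M + 1 + 2 * i)) * (\<Prod>j\<in>{N..<m}. 1 - a * Q ^ (2 * M + 1 + j)))"
      unfolding pR by (simp add: prod.distrib mult_ac)
    moreover have "rahman_prod Q a w c 1 M m * K = rahman_prod Q a w c 1 0 m *
       ((\<Prod>i<N. Q ^ N - a * Q ^ (2 * M + 1 + 2 * i)) * (\<Prod>j\<in>{N..<m}. 1 - a * Q ^ (2 * M + 1 + j)))"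
      unfolding K_def c_def w_def using rahman_prod_ratio[OF aQ N M, of 1] by (simp add: m_def mult_ac)
    ultimately show "poly p x = 0"
      unfolding p_def x using rahman_sum_terminating[OF Q0 Q1 f0 M, of a w c]
      by (simp add: poly_rahman_sum_const f1 mult_ac)
  qed
  hence "K * rahman_sum Q a w c e f m = rahman_prod Q a w c 1 0 m * poly R e"
    using poly_rahman_sum_const[of Q a w c f m e] by (metis eq_iff_diff_eq_0 p_def poly_0 poly_diff poly_smult)
  moreover have "poly R e = 0"
  proof -
    \<comment> \<open>Since \<open>f = a * e\<close>, the factor of index \<open>i\<close> is
      \<open>f * (Q^N - Q^(1+2*i))\<close>.\<close>
    obtain i where i: "N = 2 * i + 1" using oN by (elim oddE)
    have "(\<Prod>i<N. f * Q ^ N - a * e * Q ^ (1 + 2 * i)) = 0"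
      by (rule prod_zero) (auto intro!: bexI[of _ i] simp: f i)
    thus ?thesis unfolding pR by simp
  qed
  moreover have "K \<noteq> 0"
    unfolding K_def using N aQ[of "1 + _"] by (auto simp: add.commute)
  ultimately show ?thesis unfolding c_def w_def m_def by simp
qed

subsection \<open>Primitive roots of unity\<close>

text \<open>Moving the argument gains the factor \<open>x - y\<close> on top of any common divisor
  \<open>c\<close> of the coefficients. This carries divisibility from special parameter values to
  \<open>b = d = q\<close>.\<close>

lemma diff_dvd_poly_diff:
  fixes p :: "'a::idom poly"
  assumes "\<And>i. c dvd coeff p i"
  shows "c * (x - y) dvd poly p x - poly p y"
proof -
  have xy: "x - y dvd poly q x - poly q y" for q
  proof (induction q)
    case (pCons a q)
    have "poly (pCons a q) x - poly (pCons a q) y = (x - y) * poly q x + y * (poly q x - poly q y)"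
      by (simp add: algebra_simps)
    with pCons.IH show ?case by simp
  qed simp
  from assms obtain q where "p = [:c:] * q" by (metis const_poly_dvd_iff dvdE)
  hence "poly p x - poly p y = c * (poly q x - poly q y)" by (simp add: algebra_simps)
  thus ?thesis using xy by (simp add: mult_dvd_mono)
qed

text \<open>The outer variable is a parameter, the inner one is \<open>q\<close>. Reducing the
  coefficients at \<open>z\<close> leaves a polynomial that vanishes everywhere, hence is zero in
  characteristic 0.\<close>

lemma dvd_coeff_if_eval_eq_0:
  fixes p :: "'a::{idom, ring_char_0} poly poly"
  assumes "\<And>x. poly (poly p [:x:]) z = 0"
  shows "[:-z, 1:] dvd coeff p i"
proof -
  define h where "h = map_poly (\<lambda>c. poly c z) p"
  have "poly h x = poly (poly p [:x:]) z" for x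
    unfolding h_def by (induction p) (simp_all add: map_poly_pCons)
  hence "h = 0" using assms by (simp add: poly_all_0_iff_0[symmetric])
  moreover have "coeff h i = poly (coeff p i) z" unfolding h_def by (simp add: coeff_map_poly)
  ultimately show ?thesis by (simp add: poly_eq_0_iff_dvd[symmetric])
qed

lemma dvd_coeff_if_eval2_eq_0:
  fixes p :: "'a::{idom, ring_char_0} poly poly poly"
  assumes "\<And>x y. poly (poly (poly p [:[:x:]:]) [:y:]) z = 0"
  shows "[:[:-z, 1:]:] dvd coeff p i"
  unfolding const_poly_dvd_iff
proof (intro allI dvd_coeff_if_eval_eq_0)
  fix y
  define h where "h = map_poly (\<lambda>c. poly c [:y:]) p"
  have "poly h [:x:] = poly (poly p [:[:x:]:]) [:y:]" for x
    unfolding h_def by (induction p) (simp_all add: map_poly_pCons)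
  hence "[:-z, 1:] dvd coeff h i" using assms by (intro dvd_coeff_if_eval_eq_0) simp
  moreover have "coeff h i = poly (coeff p i) [:y:]" unfolding h_def by (simp add: coeff_map_poly)
  ultimately show "poly (poly (coeff p i) [:y:]) z = 0" by (simp add: poly_eq_0_iff_dvd)
qed

lemma X_power_inject: "[:0, 1::'a::idom:] ^ i = [:0, 1:] ^ j \<longleftrightarrow> i = j"
  by (metis degree_linear_power)

lemma dvd_one_minus_X_power: "(z::'a::comm_ring_1) ^ k = 1 \<Longrightarrow> [:-z, 1:] dvd 1 - [:0, 1:] ^ k"
  by (simp add: poly_eq_0_iff_dvd[symmetric])

lemma rahman_sum_dvd_root_of_unity:
  fixes z :: complex and n :: nat
  defines "X \<equiv> [:0, 1:]"
  assumes z: "z ^ n = 1" and n: "n mod 4 = 3"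
  shows "[:-z, 1:] ^ 4 dvd rahman_sum (X\<^sup>2) X (2 * X ^ n) (X ^ (n - 1)) 1 X (n - 1)"
proof -
  define t where "t = [:-z, 1:]"
  define m where "m = n - 1"
  define Q where "Q = X\<^sup>2"
  define c where "c = X ^ (n - 1)"
  \<comment> \<open>\<open>w0/c = q^(1-n) + q^(n+1)\<close> encodes \<open>b = q^(1-n)\<close>, and
    \<open>w1/c = 2*q\<close> encodes \<open>b = q\<close>.\<close>
  define w0 where "w0 = 1 + X ^ (2 * n)"
  define w1 where "w1 = 2 * X ^ n"
  \<comment> \<open>By \<open>n mod 4 = 3\<close> the division is exact, and
    \<open>e = X^(3*n)\<close> below encodes \<open>d = q^(1-3*n)\<close>.\<close>
  define M where "M = (3 * n - 1) div 4"
  have M: "4 * M + 1 = 3 * n" unfolding M_def using n by presburger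
  have Mm: "M \<le> m" unfolding m_def using M by linarith
  define e where "e = X * Q ^ (2 * M)"
  have e: "e = X ^ (3 * n)" unfolding e_def Q_def M[symmetric] by (simp add: power_mult[symmetric])
  have n0: "n > 0" and on: "odd n" using n by presburger+
  have Q0: "Q \<noteq> 0" and X0: "X \<noteq> 0" unfolding Q_def X_def by simp_all
  have Xi: "X ^ i = X ^ j \<longleftrightarrow> i = j" for i j unfolding X_def by (rule X_power_inject)
  have Qp: "Q ^ i = X ^ (2 * i)" for i unfolding Q_def by (simp add: power_mult)
  have Q1: "Q ^ i \<noteq> 1" if "i > 0" for i using that Xi[of "2 * i" 0] unfolding Qp by simp
  have tX: "t dvd 1 - X ^ k" if "z ^ k = 1" for k
    unfolding t_def X_def by (rule dvd_one_minus_X_power[OF that])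
  have tn: "t dvd 1 - X ^ n" and t3n: "t dvd 1 - X ^ (3 * n)"
    by (rule tX, use z in \<open>simp add: power_mult mult.commute[of 3]\<close>)+
  \<comment> \<open>In \<open>p\<close> both \<open>w\<close> (outermost) and \<open>e\<close> are
    indeterminates, in \<open>pw\<close> only \<open>e\<close>, in \<open>s\<close> neither.\<close>
  define p where "p = rahman_sum [:[:Q:]:] [:[:X:]:] [:0, 1:] [:[:c:]:] [:[:0, 1:]:] [:[:X:]:] m"
  define pw where "pw w = rahman_sum [:Q:] [:X:] [:w:] [:c:] [:0, 1:] [:X:] m" for w
  define s where "s w e = rahman_sum Q X w c e X m" for w e
  have pw: "poly p [:w:] = pw w" for w
    unfolding p_def pw_def by (simp add: poly_rahman_sum)
  have s: "poly (pw w) e = s w e" for w e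
    unfolding s_def pw_def by (rule poly_rahman_sum_const)
  have "[:t:] dvd coeff p i" for i
    unfolding t_def
  proof (rule dvd_coeff_if_eval2_eq_0)
    fix w e
    have z0: "z \<noteq> 0" using z n0 by (auto simp: power_0_left)
    have "poly (poly (poly p [:[:w:]:]) [:e:]) z = poly (s [:w:] [:e:]) z" by (simp add: pw s)
    also have "\<dots> = rahman_sum (z\<^sup>2) z w (z ^ (n - 1)) e z (n - 1)"
      unfolding s_def Q_def c_def X_def m_def by (simp add: poly_rahman_sum)
    also have "\<dots> = 0" by (rule rahman_sum_root_of_unity[OF z on z0])
    finally show "poly (poly (poly p [:[:w:]:]) [:e:]) z = 0" .
  qed
  from diff_dvd_poly_diff[OF this, of "[:w1:]" "[:w0:]"]
  have "[:t:] * ([:w1:] - [:w0:]) dvd pw w1 - pw w0" unfolding pw .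
  \<comment> \<open>\<open>g\<close> is a polynomial in \<open>e\<close>: the difference quotient in
    \<open>w\<close> with one \<open>t\<close> taken out. The aim is that \<open>t\<close> divides
    \<open>g\<close> at \<open>e = 1\<close>.\<close>
  then obtain g where g: "pw w1 - pw w0 = [:t * (w1 - w0):] * g" by (auto simp: mult.commute)
  have gs: "s w1 e - s w0 e = t * (w1 - w0) * poly g e" for e
    using arg_cong[OF g, of "\<lambda>q. poly q e"] by (simp add: s)
  define r where "r = rahman_sum [:Q:] [:X:] [:0, 1:] [:c:] [:e:] [:X:] m"
  have rs: "poly r w = s w e" for w
    unfolding r_def s_def by (simp add: poly_rahman_sum)
  \<comment> \<open>At this \<open>e\<close> the closed form contains \<open>1 - X^n\<close> (index
    \<open>i\<close>) and \<open>1 - X^(3*n)\<close> (index \<open>2*M\<close>), both divisible by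
    \<open>t\<close>.\<close>
  have "[:t\<^sup>2:] dvd r"
  proof -
    have "r = rahman_sum [:Q:] [:X:] [:0, 1:] [:c:] ([:X:] * [:Q:] ^ (2 * M)) [:X:] m"
      unfolding r_def e_def by (simp add: const_poly_power mult.commute)
    also have "\<dots> = rahman_prod [:Q:] [:X:] [:0, 1:] [:c:] [:X:] M m"
      by (rule rahman_sum_terminating) (use Q0 Q1 X0 Mm in \<open>auto simp: const_poly_power one_pCons\<close>)
    finally have r: "r = rahman_prod [:Q:] [:X:] [:0, 1:] [:c:] [:X:] M m" .
    define i where "i = (n - 1) div 2"
    have i: "2 * i + 1 = n" unfolding i_def using on by presburger
    have f: "1 - [:X:] * [:Q:] ^ j = [:1 - X ^ (2 * j + 1):]" for j
      by (simp add: const_poly_power one_pCons Qp mult.commute)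
    have cd: "[:u:] dvd [:v:]" if "u dvd v" for u v :: "complex poly"
      using that by (elim dvdE) (simp add: const_poly_dvd_iff coeff_pCons split: nat.split)
    have "4 * M + 1 = 3 * n" by (rule M)
    hence "2 * (2 * M) + 1 = 3 * n" by simp
    hence d: "[:t:] dvd 1 - [:X:] * [:Q:] ^ i" "[:t:] dvd 1 - [:X:] * [:Q:] ^ (2 * M)"
      unfolding f i using tn t3n by (auto intro!: cd)
    have lt: "i < 2 * M" using i M n0 by linarith
    have "{..<2 * M + 1} = insert i (insert (2 * M) ({..<2 * M} - {i}))" using lt by auto
    hence "(\<Prod>j<2*M+1. 1 - [:X:] * [:Q:] ^ j) = (1 - [:X:] * [:Q:] ^ i) * ((1 - [:X:] * [:Q:] ^ (2 * M)) *
       (\<Prod>j\<in>{..<2*M}-{i}. 1 - [:X:] * [:Q:] ^ j))"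
      using lt by simp
    hence "[:t:] * [:t:] dvd (\<Prod>j<2*M+1. 1 - [:X:] * [:Q:] ^ j)"
      using d by (simp only: mult_dvd_mono dvd_mult2)
    moreover have "[:t:] * [:t:] = [:t\<^sup>2:]" by (simp add: power2_eq_square)
    ultimately show ?thesis unfolding r rahman_prod_def by (metis dvd_mult dvd_mult2)
  qed
  hence "t\<^sup>2 dvd coeff r i" for i by (simp add: const_poly_dvd_iff)
  from diff_dvd_poly_diff[OF this, of w1 w0]
  have "t * (w1 - w0) * t dvd t * (w1 - w0) * poly g e"
    unfolding rs gs by (simp add: power2_eq_square mult_ac)
  moreover have w: "w1 - w0 = - ((1 - X ^ n)\<^sup>2)"
  proof -
    have "X ^ (2 * n) = (X ^ n)\<^sup>2" by (simp add: power_mult[symmetric] mult.commute)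
    thus ?thesis unfolding w1_def w0_def by (simp add: power2_diff)
  qed
  \<comment> \<open>This permits cancelling \<open>t * (w1 - w0)\<close>, so that \<open>t\<close>
    divides \<open>g\<close> at \<open>e = X^(3*n)\<close>.\<close>
  have "w1 - w0 \<noteq> 0" unfolding w using Xi[of n 0] n0 by auto
  moreover have "t \<noteq> 0" unfolding t_def by simp
  ultimately have "t dvd poly g e" by simp
  moreover have "t dvd poly g 1 - poly g e"
  proof -
    have "1 * (1 - e) dvd poly g 1 - poly g e" by (rule diff_dvd_poly_diff) simp
    moreover have "t dvd 1 - e" unfolding e by (rule t3n)
    ultimately show ?thesis by (metis dvd_trans mult_1)
  qed
  ultimately have "t dvd poly g 1" by (metis dvd_add_right_iff diff_add_cancel dvd_add)
  moreover have "t * t dvd w1 - w0" unfolding w using tn by (simp add: power2_eq_square mult_dvd_mono)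
  \<comment> \<open>One \<open>t\<close> comes from the coefficients of \<open>p\<close>, two from
    \<open>w1 - w0\<close>, one from \<open>g\<close>.\<close>
  ultimately have "t * (t * t) * t dvd t * (w1 - w0) * poly g 1" by (intro mult_dvd_mono dvd_refl)
  \<comment> \<open>The case \<open>b = Q^(-N)\<close>, \<open>d = a = q\<close>; here
    \<open>N\<close> is odd because \<open>n mod 4 = 3\<close>.\<close>
  moreover have "s w0 1 = 0"
  proof -
    define N where "N = (n - 1) div 2"
    have N: "n = 2 * N + 1" unfolding N_def using on by presburger
    have oN: "odd N" using N n by presburger
    have "rahman_sum Q X (1 + Q ^ (2 * N + 1)) (Q ^ N) 1 X (2 * N) = 0"
    proof (rule rahman_sum_eq_0_if_odd)
      show "X * Q ^ i \<noteq> 1" for i using Xi[of "2 * i + 1" 0] unfolding Qp by simp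
      show "Q ^ N \<noteq> X * Q ^ (2 * j + 1)" for j
      proof -
        have "X * Q ^ (2 * j + 1) = X ^ (4 * j + 3)"
          unfolding Qp power_Suc[symmetric] by (rule arg_cong[of _ _ "\<lambda>k. X ^ k"]) simp
        moreover have "2 * N \<noteq> 4 * j + 3" by presburger
        ultimately show ?thesis unfolding Qp using Xi by simp
      qed
    qed (use Q0 Q1 X0 oN in auto)
    thus ?thesis unfolding s_def w0_def c_def m_def N Qp by (simp add: mult.assoc)
  qed
  ultimately have "t * (t * t) * t dvd s w1 1" using gs[of 1] by simp
  thus ?thesis unfolding s_def Q_def w1_def c_def m_def t_def by (simp add: numeral_eq_Suc mult_ac)
qed

subsection \<open>Roots of unity of smaller order\<close>

text \<open>The \<open>j\<close>-th factor of the numerator; \<open>x^(2*j+2)\<close> is the share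
  of \<open>q^(k\<^sup>2+k)\<close> that belongs to it.\<close>

definition term_num :: "'a::comm_ring_1 \<Rightarrow> nat \<Rightarrow> 'a" where
  "term_num x j = (1 - x ^ (2 * j + 1)) ^ 3 * (1 - x ^ (4 * j + 1)) * x ^ (2 * j + 2)"

definition term_den :: "'a::comm_ring_1 \<Rightarrow> nat \<Rightarrow> 'a" where
  "term_den x j = (1 - x ^ (2 * j + 2)) * (1 - x ^ (4 * j + 4)) ^ 3"

text \<open>For \<open>m = n - 1\<close> this is the sum of the theorem multiplied by
  \<open>1 - q\<close> and by every denominator.\<close>

definition cleared_sum :: "'a::comm_ring_1 \<Rightarrow> nat \<Rightarrow> 'a" where
  "cleared_sum x m =
     (\<Sum>k\<le>m. (1 - x ^ (6 * k + 1)) * (\<Prod>j<k. term_num x j) * (\<Prod>j\<in>{k..<m}. term_den x j))"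

lemma (in unital_ring_hom) hom_term_den: "h (term_den x j) = term_den (h x) j"
  unfolding term_den_def by (simp only: hom_simps)

lemma (in unital_ring_hom) hom_cleared_sum: "h (cleared_sum x m) = cleared_sum (h x) m"
  unfolding cleared_sum_def term_num_def term_den_def by (simp only: hom_simps)

text \<open>The specialisation \<open>a = b = d = q\<close>, \<open>Q = q\<^sup>2\<close>. As
  \<open>b = Q/b\<close>, the quadratic factors become squares; each numerator or denominator factor
  carries an extra \<open>x ^ n\<close>.\<close>

lemma rahman_sum_eq_cleared_sum:
  assumes "n > 0"
  shows "rahman_sum (x\<^sup>2) x (2 * x ^ n) (x ^ (n - 1)) 1 x m = x ^ (n * m) * cleared_sum x m"
proof -
  define u where "u = x ^ (n - 1)"
  have n: "x ^ n = x * u" using assms by (cases n) (simp_all add: u_def)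
  have sq: "u * (1 + v\<^sup>2) - 2 * (u * v) = u * (1 - v)\<^sup>2" for v
    by (simp add: power2_diff algebra_simps)
  have num: "rahman_num (x\<^sup>2) x (2 * x ^ n) u 1 x j = x ^ n * term_num x j" for j
  proof -
    define v where "v = x ^ (2 * j + 1)"
    have p: "x * (x\<^sup>2) ^ j = v" "x * (x\<^sup>2) ^ (j + 1) = x ^ (2 * j + 2) * x" "(x\<^sup>2) ^ (2 * j + 1) = v\<^sup>2"
      "x * (x\<^sup>2) ^ (2 * j) = x ^ (4 * j + 1)" "2 * (x * u) * (x\<^sup>2) ^ j = 2 * (u * v)"
      unfolding v_def
      by (simp_all add: power_mult[symmetric] power_add[symmetric] mult.commute mult.left_commute flip: power_Suc) (simp_all add: power_mult power_add power2_eq_square mult_ac)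
    show ?thesis unfolding rahman_num_def n p sq term_num_def v_def[symmetric]
      by (simp add: power2_eq_square power3_eq_cube mult_ac)
  qed
  have den: "rahman_den (x\<^sup>2) x (2 * x ^ n) u 1 x j = x ^ n * term_den x j" for j
  proof -
    define v where "v = x ^ (4 * j + 4)"
    have p: "(x\<^sup>2) ^ (2 * j + 2) = v" "x\<^sup>2 * (x\<^sup>2) ^ (4 * j + 3) = v\<^sup>2"
      "2 * (x * u) * x * (x\<^sup>2) ^ (2 * j + 1) = 2 * (u * v)" "x - x * 1 * (x\<^sup>2) ^ (j + 1) = x * (1 - x ^ (2 * j + 2))"
      unfolding v_def power_mult[symmetric] power_add[symmetric]
      by (simp_all add: algebra_simps power_add numeral_eq_Suc power_mult)
    show ?thesis unfolding rahman_den_def rahman_quad_def n p sq term_den_def v_def[symmetric]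
      by (simp add: power2_eq_square power3_eq_cube mult_ac)
  qed
  have "(1 - x * (x\<^sup>2) ^ (3 * k)) * (\<Prod>j<k. x ^ n * term_num x j) * (\<Prod>j\<in>{k..<m}. x ^ n * term_den x j)
    = x ^ (n * m) * ((1 - x ^ (6 * k + 1)) * (\<Prod>j<k. term_num x j) * (\<Prod>j\<in>{k..<m}. term_den x j))"
    if "k \<in> {..m}" for k
  proof -
    have "(x ^ n) ^ k * (x ^ n) ^ (m - k) = x ^ (n * m)"
      using that by (simp add: power_add[symmetric] power_mult)
    moreover have "x * (x\<^sup>2) ^ (3 * k) = x ^ (6 * k + 1)" by (simp add: power_mult[symmetric])
    moreover have "a * (\<Prod>j<k. x ^ n * term_num x j) * (\<Prod>j\<in>{k..<m}. x ^ n * term_den x j)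
      = (x ^ n) ^ k * (x ^ n) ^ (m - k) * (a * (\<Prod>j<k. term_num x j) * (\<Prod>j\<in>{k..<m}. term_den x j))" for a
      by (simp add: prod.distrib mult_ac)
    ultimately show ?thesis by simp
  qed
  thus ?thesis
    unfolding u_def[symmetric] rahman_sum_def num den cleared_sum_def sum_distrib_left by (intro sum.cong refl)
qed

text \<open>A run of \<open>d\<close> summands from index \<open>r\<close> with its common factors
  removed. The denominators stop before \<open>d - 1\<close>, since the one at
  \<open>r + d - 1\<close> is shared by the whole run, or absent from it if the run is the
  last.\<close>

definition cleared_block :: "'a::comm_ring_1 \<Rightarrow> nat \<Rightarrow> nat \<Rightarrow> 'a" where
  "cleared_block x d r = (\<Sum>j<d. (1 - x ^ (6 * (r + j) + 1)) * (\<Prod>i<j. term_num x (r + i))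
     * (\<Prod>i\<in>{j..<d - 1}. term_den x (r + i)))"

lemma (in unital_ring_hom) hom_cleared_block: "h (cleared_block x d r) = cleared_block (h x) d r"
  unfolding cleared_block_def term_num_def term_den_def by (simp only: hom_simps)

lemma cleared_sum_blocks:
  assumes d: "d > 0" and l: "l > 0"
  shows "cleared_sum x (d * l - 1) = (\<Sum>s<l. (\<Prod>i<s * d. term_num x i)
     * (\<Prod>i\<in>{s * d + (d - 1)..<d * l - 1}. term_den x i) * cleared_block x d (s * d))"
proof -
  define f where "f k = (1 - x ^ (6 * k + 1)) * (\<Prod>j<k. term_num x j) * (\<Prod>j\<in>{k..<d * l - 1}. term_den x j)" for k
  have "{..k - 1} = {..<k}" if "k > 0" for k :: nat using that by auto
  hence "{..d * l - 1} = {..<l * d}" using d l by (simp add: mult.commute)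
  hence "cleared_sum x (d * l - 1) = sum f {..<l * d}" unfolding cleared_sum_def f_def by simp
  also have "\<dots> = (\<Sum>s<l. sum f {s * d..<s * d + d})" by (rule sum.nat_group[symmetric])
  also have "\<dots> = (\<Sum>s<l. (\<Prod>i<s * d. term_num x i)
     * (\<Prod>i\<in>{s * d + (d - 1)..<d * l - 1}. term_den x i) * cleared_block x d (s * d))"
  proof (rule sum.cong[OF refl])
    fix s assume "s \<in> {..<l}"
    hence "Suc s \<le> l" by simp
    hence "Suc s * d \<le> l * d" by (rule mult_le_mono1)
    hence sl: "s * d + (d - 1) \<le> d * l - 1" using d by (simp add: mult.commute)
    have "sum f {s * d..<s * d + d} = (\<Sum>j<d. f (j + s * d))"
      using sum.shift_bounds_nat_ivl[of f 0 "s * d" d] by (simp add: add.commute atLeast0LessThan)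
    also have "f (j + s * d) = (\<Prod>i<s * d. term_num x i) * (\<Prod>i\<in>{s * d + (d - 1)..<d * l - 1}. term_den x i)
      * ((1 - x ^ (6 * (s * d + j) + 1)) * (\<Prod>i<j. term_num x (s * d + i)) * (\<Prod>i\<in>{j..<d - 1}. term_den x (s * d + i)))"
      if "j < d" for j
    proof -
      have "(\<Prod>i<j + s * d. term_num x i) = (\<Prod>i<s * d. term_num x i) * (\<Prod>i\<in>{s * d..<j + s * d}. term_num x i)"
        by (metis atLeast0LessThan prod.atLeastLessThan_concat zero_le le_add2)
      moreover have "(\<Prod>i\<in>{s * d..<j + s * d}. term_num x i) = (\<Prod>i<j. term_num x (s * d + i))"
        using prod.shift_bounds_nat_ivl[of "term_num x" 0 "s * d" j] by (simp add: add.commute atLeast0LessThan)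
      moreover have "(\<Prod>i\<in>{j + s * d..<d * l - 1}. term_den x i)
        = (\<Prod>i\<in>{j + s * d..<(d - 1) + s * d}. term_den x i) * (\<Prod>i\<in>{s * d + (d - 1)..<d * l - 1}. term_den x i)"
        using that sl by (subst prod.atLeastLessThan_concat[symmetric, of _ "(d - 1) + s * d"]) (auto simp: add.commute)
      moreover have "(\<Prod>i\<in>{j + s * d..<(d - 1) + s * d}. term_den x i) = (\<Prod>i\<in>{j..<d - 1}. term_den x (s * d + i))"
        by (simp only: prod.shift_bounds_nat_ivl add.commute)
      ultimately show ?thesis unfolding f_def by (simp add: add.commute mult_ac)
    qed
    ultimately show "sum f {s * d..<s * d + d} = (\<Prod>i<s * d. term_num x i)
     * (\<Prod>i\<in>{s * d + (d - 1)..<d * l - 1}. term_den x i) * cleared_block x d (s * d)"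
      unfolding cleared_block_def sum_distrib_left by simp
  qed
  finally show ?thesis .
qed

text \<open>Exponents count only modulo \<open>d\<close>, so every block equals the first, which is
  the cleared sum with \<open>d\<close> in place of \<open>n\<close> and vanishes by the terminating
  case.\<close>

lemma cleared_block_root_of_unity:
  fixes z :: complex
  assumes z: "z ^ d = 1" and d: "odd d"
  shows "cleared_block z d (s * d) = 0"
proof -
  have d0: "d > 0" using d by (rule odd_pos)
  have z0: "z \<noteq> 0" using z d0 by (auto simp: power_0_left)
  have zp: "z ^ (a * (s * d + j) + b) = z ^ (a * j + b)" for a b j
  proof -
    have "z ^ (a * (s * d + j) + b) = (z ^ d) ^ (a * s) * z ^ (a * j + b)"
      by (simp add: power_mult[symmetric] power_add[symmetric] algebra_simps)
    thus ?thesis by (simp add: z)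
  qed
  have "cleared_block z d (s * d) = cleared_block z d 0"
    unfolding cleared_block_def term_num_def term_den_def zp by simp
  also have "\<dots> = cleared_sum z (d - 1)"
    unfolding cleared_block_def cleared_sum_def using d0 by (intro sum.cong) auto
  also have "\<dots> = 0"
    using rahman_sum_root_of_unity[OF z d z0, of "2 * z ^ d" "z ^ (d - 1)" 1]
      rahman_sum_eq_cleared_sum[OF d0, of z "d - 1"] z0 by simp
  finally show ?thesis .
qed

section \<open>Orders of vanishing at a root of unity of odd order\<close>

lemma term_den_X_neq_0: "term_den [:0, 1:] j \<noteq> (0 :: 'a::idom poly)"
proof -
  have "1 - [:0, 1:] ^ k \<noteq> (0 :: 'a poly)" if "k > 0" for k
    using X_power_inject[of 0 k] that by auto
  from this[of "2 * j + 2"] this[of "4 * j + 4"] show ?thesis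
    unfolding term_den_def by (simp only: mult_eq_0_iff power_eq_0_iff) simp
qed

text \<open>The derivative of \<open>1 - X^k\<close> is nonzero away from \<open>0\<close>, so its
  zeros are simple.\<close>

lemma order_one_minus_X_power:
  fixes z :: complex
  assumes "k > 0" and "z \<noteq> 0"
  shows "order z (1 - [:0, 1:] ^ k) = (if z ^ k = 1 then 1 else 0)"
proof (cases "z ^ k = 1")
  case True
  obtain j where k: "k = Suc j" using assms(1) by (cases k) auto
  have "pderiv (1 - [:0, 1 :: complex:] ^ k) = - smult (of_nat k) ([:0, 1:] ^ j)"
    unfolding k pderiv_diff pderiv_power_Suc by (simp add: pderiv_pCons del: power_Suc)
  hence "poly (pderiv (1 - [:0, 1:] ^ k)) z \<noteq> 0" using assms by simp
  hence "order z (pderiv (1 - [:0, 1:] ^ k)) = 0" by (rule order_0I)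
  moreover have "1 - [:0, 1:] ^ k \<noteq> (0 :: complex poly)"
    using X_power_inject[of 0 k] assms(1) by auto
  ultimately show ?thesis using order_pderiv[of "1 - [:0, 1:] ^ k" z] True by simp
next
  case False
  thus ?thesis by (auto intro: order_0I)
qed

lemma order_prod:
  assumes "\<And>x. x \<in> A \<Longrightarrow> f x \<noteq> (0 :: 'a::idom poly)"
  shows "order z (prod f A) = (\<Sum>x\<in>A. order z (f x))"
  using assms
proof (induction A rule: infinite_finite_induct)
  case (insert x A)
  hence "f x * prod f A \<noteq> 0" by auto
  thus ?case using insert by (simp add: order_mult)
qed simp_all

lemma order_power:
  assumes "p \<noteq> (0 :: 'a::idom poly)"
  shows "order z (p ^ k) = k * order z p"
  using assms by (induction k) (simp_all add: order_mult)

context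
  fixes z :: complex and d :: nat
  assumes z: "\<And>k. z ^ k = 1 \<longleftrightarrow> d dvd k" and d: "odd d"
begin

lemma root_nonzero: "z \<noteq> 0"
  using z[of d] odd_pos[OF d] by (auto simp: power_0_left)

lemma linear_dvd_one_minus_X_power: "d dvd k \<Longrightarrow> [:-z, 1:] dvd 1 - [:0, 1:] ^ k"
  by (rule dvd_one_minus_X_power) (simp add: z)

lemma order_one_minus_X_power_root: "k > 0 \<Longrightarrow> order z (1 - [:0, 1:] ^ k) = (if d dvd k then 1 else 0)"
  using order_one_minus_X_power[OF _ root_nonzero] by (simp add: z)

lemma term_den_dvd:
  assumes "d dvd j + 1"
  shows "[:-z, 1:] ^ 4 dvd term_den [:0, 1:] j"
proof -
  have "2 * j + 2 = 2 * (j + 1)" "4 * j + 4 = 4 * (j + 1)" by simp_all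
  hence "d dvd 2 * j + 2" "d dvd 4 * j + 4" using assms by (metis dvd_mult)+
  hence "[:-z, 1:] * [:-z, 1:] ^ 3 dvd term_den [:0, 1:] j"
    unfolding term_den_def by (intro mult_dvd_mono dvd_power_same linear_dvd_one_minus_X_power)
  thus ?thesis by (simp only: power_Suc[symmetric]) simp
qed

text \<open>As \<open>d\<close> is odd, both factors of \<open>term_den\<close> vanish at
  \<open>z\<close> exactly when \<open>d dvd j + 1\<close>, with multiplicities \<open>1\<close> and
  \<open>3\<close>; this happens for \<open>l - 1\<close> indices.\<close>

lemma order_prod_term_den:
  assumes "l > 0"
  shows "order z (\<Prod>j<d * l - 1. term_den [:0, 1:] j) = 4 * (l - 1)"
proof -
  have ne: "1 - [:0, 1:] ^ k \<noteq> (0 :: complex poly)" if "k > 0" for k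
    using X_power_inject[of 0 k] that by auto
  have o: "order z (term_den [:0, 1:] j) = (if d dvd j + 1 then 4 else 0)" for j
  proof -
    have "d dvd 2 * (j + 1) \<longleftrightarrow> d dvd j + 1"
      by (rule coprime_dvd_mult_right_iff) (use d in simp)
    moreover have "coprime d (2 ^ 2)" using d by (intro coprime_power_right_iff[THEN iffD2]) simp
    hence "d dvd 4 * (j + 1) \<longleftrightarrow> d dvd j + 1"
      by (intro coprime_dvd_mult_right_iff) simp
    moreover have "2 * j + 2 = 2 * (j + 1)" "4 * j + 4 = 4 * (j + 1)" by simp_all
    ultimately have o: "order z (1 - [:0, 1:] ^ (2 * j + 2)) = (if d dvd j + 1 then 1 else 0)"
      "order z (1 - [:0, 1:] ^ (4 * j + 4)) = (if d dvd j + 1 then 1 else 0)"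
      by (simp_all only: order_one_minus_X_power_root add_gr_0 zero_less_numeral simp_thms)
    have n: "1 - [:0, 1:] ^ (2 * j + 2) \<noteq> (0 :: complex poly)" "1 - [:0, 1:] ^ (4 * j + 4) \<noteq> (0 :: complex poly)"
      by (rule ne, simp)+
    have "order z (term_den [:0, 1:] j) = order z (1 - [:0, 1:] ^ (2 * j + 2)) + 3 * order z (1 - [:0, 1:] ^ (4 * j + 4))"
      unfolding term_den_def order_power[OF n(2), symmetric]
      by (rule order_mult) (metis n mult_eq_0_iff power_not_zero)
    thus ?thesis unfolding o by simp
  qed
  have d0: "d > 0" using d by (rule odd_pos)
  \<comment> \<open>The limit is \<open>d * (l + 1) - 1\<close>. Each induction step adds a window
    of \<open>d\<close> indices, of which only the first is counted.\<close>
  have "(\<Sum>j<d * l + (d - 1). if d dvd j + 1 then 4 else 0 :: nat) = 4 * l" for l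
  proof (induction l)
    case 0
    have "\<not> d dvd Suc j" if "j < d - 1" for j using that by (auto dest: dvd_imp_le)
    thus ?case by simp
  next
    case (Suc l)
    define N where "N = d * l + (d - 1)"
    have N: "d dvd N + 1" unfolding N_def using d0 by simp
    have no: "\<not> d dvd j + 1" if "j \<in> {Suc N..<N + d}" for j
    proof
      assume "d dvd j + 1"
      hence "d dvd (j + 1) - (N + 1)" using N by (rule dvd_diff_nat)
      thus False using that by (auto dest: dvd_imp_le)
    qed
    have "(\<Sum>j<N + d. if d dvd j + 1 then 4 else 0 :: nat)
      = (\<Sum>j<N. if d dvd j + 1 then 4 else 0) + (\<Sum>j\<in>{N..<N + d}. if d dvd j + 1 then 4 else 0)"
      by (metis atLeast0LessThan sum.atLeastLessThan_concat zero_le le_add1)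
    also have "(\<Sum>j\<in>{N..<N + d}. if d dvd j + 1 then 4 else 0 :: nat) = 4"
    proof -
      have "{N..<N + d} = insert N {Suc N..<N + d}" using d0 by auto
      moreover have "(\<Sum>j\<in>{Suc N..<N + d}. if d dvd j + 1 then 4 else 0 :: nat) = 0"
        by (rule sum.neutral) (use no in auto)
      ultimately show ?thesis using N by simp
    qed
    finally show ?case using Suc.IH unfolding N_def by (simp add: algebra_simps)
  qed
  from this[of "l - 1"] assms d0
  have "(\<Sum>j<d * l - 1. if d dvd j + 1 then 4 else 0 :: nat) = 4 * (l - 1)"
    by (cases l) (simp_all add: algebra_simps)
  thus ?thesis by (simp only: order_prod[OF term_den_X_neq_0] o)
qed

text \<open>The range consists of \<open>k\<close> windows of length \<open>d\<close>, each
  beginning at an index \<open>N\<close> with \<open>d dvd N + 1\<close>.\<close>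

lemma term_den_prod_dvd:
  assumes "d dvd r + 1"
  shows "[:-z, 1:] ^ (4 * k) dvd (\<Prod>i\<in>{r..<r + k * d}. term_den [:0, 1:] i)"
proof (induction k)
  case (Suc k)
  define N where "N = r + k * d"
  have "d dvd N + 1" using dvd_add[OF assms dvd_triv_right[of d k]] by (simp add: N_def add.commute add.left_commute)
  hence "[:-z, 1:] ^ 4 dvd term_den [:0, 1:] N" by (rule term_den_dvd)
  moreover have "term_den [:0, 1:] N dvd (\<Prod>i\<in>{N..<N + d}. term_den [:0, 1 :: complex:] i)"
    by (rule dvd_prodI) (use odd_pos[OF d] in auto)
  ultimately have "[:-z, 1:] ^ (4 * k) * [:-z, 1:] ^ 4 dvd
      (\<Prod>i\<in>{r..<N}. term_den [:0, 1:] i) * (\<Prod>i\<in>{N..<N + d}. term_den [:0, 1:] i)"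
    using Suc.IH unfolding N_def by (intro mult_dvd_mono) (auto intro: dvd_trans)
  also have "\<dots> = (\<Prod>i\<in>{r..<N + d}. term_den [:0, 1:] i)"
    by (rule prod.atLeastLessThan_concat) (simp_all add: N_def)
  finally show ?case by (simp add: N_def power_add[symmetric] algebra_simps)
qed simp

text \<open>Each window of \<open>d\<close> indices contains one with \<open>d dvd 2*i+1\<close>,
  contributing a cube, and one with \<open>d dvd 4*k+1\<close>, contributing a further
  factor.\<close>

lemma term_num_prod_dvd: "[:-z, 1:] ^ (4 * s) dvd (\<Prod>i<s * d. term_num [:0, 1:] i)"
proof (induction s)
  case (Suc s)
  let ?I = "{s * d..<s * d + d}"
  have d0: "d > 0" using d by (rule odd_pos)
  define i where "i = s * d + (d - 1) div 2"
  have i: "i \<in> ?I" unfolding i_def using d0 by auto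
  have "2 * ((d - 1) div 2) + 1 = d" using d by presburger
  hence "2 * i + 1 = (2 * s + 1) * d" unfolding i_def by (simp add: algebra_simps)
  hence "d dvd 2 * i + 1" by simp
  hence "[:-z, 1:] ^ 3 dvd (1 - [:0, 1:] ^ (2 * i + 1)) ^ 3" by (intro dvd_power_same linear_dvd_one_minus_X_power)
  also have "\<dots> dvd (\<Prod>i\<in>?I. (1 - [:0, 1:] ^ (2 * i + 1)) ^ 3)"
    by (rule dvd_prodI) (use i in auto)
  finally have 1: "[:-z, 1:] ^ 3 dvd (\<Prod>i\<in>?I. (1 - [:0, 1:] ^ (2 * i + 1)) ^ 3)" .
  \<comment> \<open>\<open>4 * i0 + 1\<close> is \<open>d\<close> or \<open>3 * d\<close>, whichever
    is \<open>1\<close> modulo \<open>4\<close>.\<close>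
  obtain i0 where i0: "i0 < d" "d dvd 4 * i0 + 1"
  proof (cases "d mod 4 = 1")
    case True
    hence "4 * ((d - 1) div 4) + 1 = d" by presburger
    moreover from this have "(d - 1) div 4 < d" by linarith
    ultimately show ?thesis using that[of "(d - 1) div 4"] by simp
  next
    case False
    hence "d mod 4 = 3" using d by presburger
    hence "4 * ((3 * d - 1) div 4) + 1 = 3 * d" by presburger
    moreover from this have "(3 * d - 1) div 4 < d" using d0 by linarith
    ultimately show ?thesis using that[of "(3 * d - 1) div 4"] by simp
  qed
  define k where "k = s * d + i0"
  have k: "k \<in> ?I" unfolding k_def using i0 by auto
  have "4 * k + 1 = (4 * i0 + 1) + (4 * s) * d" unfolding k_def by (simp add: algebra_simps)
  hence "d dvd 4 * k + 1" using i0 by (metis dvd_add dvd_triv_right)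
  hence "[:-z, 1:] dvd 1 - [:0, 1:] ^ (4 * k + 1)" by (rule linear_dvd_one_minus_X_power)
  also have "\<dots> dvd (\<Prod>i\<in>?I. 1 - [:0, 1:] ^ (4 * i + 1))"
    by (rule dvd_prodI) (use k in auto)
  finally have "[:-z, 1:] dvd (\<Prod>i\<in>?I. 1 - [:0, 1:] ^ (4 * i + 1))" .
  with 1 have "[:-z, 1:] ^ 3 * [:-z, 1:] dvd (\<Prod>i\<in>?I. term_num [:0, 1:] i)"
    unfolding term_num_def prod.distrib by (intro dvd_mult2 mult_dvd_mono)
  hence "[:-z, 1:] ^ 4 dvd (\<Prod>i\<in>?I. term_num [:0, 1:] i)"
    by (simp only: power_Suc2[symmetric]) simp
  hence "[:-z, 1:] ^ (4 * s) * [:-z, 1:] ^ 4 dvd (\<Prod>i<s * d. term_num [:0, 1:] i) * (\<Prod>i\<in>?I. term_num [:0, 1:] i)"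
    using Suc.IH by (intro mult_dvd_mono)
  also have "\<dots> = (\<Prod>i<s * d + d. term_num [:0, 1:] i)"
    by (metis atLeast0LessThan prod.atLeastLessThan_concat zero_le le_add1)
  finally show ?case by (simp add: power_add[symmetric] algebra_simps)
qed simp

text \<open>For block \<open>s\<close> the numerators before it give \<open>4 * s\<close> factors,
  the denominators after it \<open>4 * (l - 1 - s)\<close>, and the block itself, zero at
  \<open>z\<close>, one more.\<close>

lemma cleared_sum_dvd:
  assumes "l > 0"
  shows "[:-z, 1:] ^ (4 * (l - 1) + 1) dvd cleared_sum [:0, 1:] (d * l - 1)"
proof -
  have d0: "d > 0" using d by (rule odd_pos)
  have "[:-z, 1:] ^ (4 * (l - 1) + 1) dvd (\<Prod>i<s * d. term_num [:0, 1:] i)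
     * (\<Prod>i\<in>{s * d + (d - 1)..<d * l - 1}. term_den [:0, 1:] i) * cleared_block [:0, 1:] d (s * d)"
    if sl: "s < l" for s
  proof -
    obtain k where k: "l = Suc (s + k)" using less_imp_Suc_add[OF sl] by auto
    have e: "d * l - 1 = s * d + (d - 1) + k * d" unfolding k using d0 by (simp add: algebra_simps)
    have "poly (cleared_block [:0, 1:] d (s * d)) z = cleared_block z d (s * d)"
      by (subst unital_ring_hom.hom_cleared_block[OF unital_ring_hom_poly]) simp
    also have "\<dots> = 0" by (rule cleared_block_root_of_unity) (simp_all add: z d)
    finally have "[:-z, 1:] dvd cleared_block [:0, 1:] d (s * d)" by (simp add: poly_eq_0_iff_dvd)
    moreover have "d dvd s * d + (d - 1) + 1" using d0 by (simp add: add.assoc)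
    ultimately have "[:-z, 1:] ^ (4 * s) * [:-z, 1:] ^ (4 * k) * [:-z, 1:] dvd (\<Prod>i<s * d. term_num [:0, 1:] i)
     * (\<Prod>i\<in>{s * d + (d - 1)..<d * l - 1}. term_den [:0, 1:] i) * cleared_block [:0, 1:] d (s * d)"
      unfolding e by (intro mult_dvd_mono term_num_prod_dvd term_den_prod_dvd)
    thus ?thesis by (simp only: power_add[symmetric] power_Suc2[symmetric]) (simp add: k algebra_simps)
  qed
  thus ?thesis unfolding cleared_sum_blocks[OF d0 assms] by (intro dvd_sum) simp
qed

end

text \<open>The two sums differ by a power of \<open>X\<close>, which has order \<open>0\<close> at
  \<open>z\<close>.\<close>

lemma cleared_sum_dvd_primitive:
  fixes z :: complex
  assumes z: "z ^ n = 1" and n: "n mod 4 = 3"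
  shows "[:-z, 1:] ^ 4 dvd cleared_sum [:0, 1:] (n - 1)"
proof -
  have n0: "n > 0" using n by (cases n) auto
  have z0: "z \<noteq> 0" using z n0 by (auto simp: power_0_left)
  have "[:-z, 1:] ^ 4 dvd [:0, 1:] ^ (n * (n - 1)) * cleared_sum [:0, 1:] (n - 1)"
    using rahman_sum_dvd_root_of_unity[OF z n] unfolding rahman_sum_eq_cleared_sum[OF n0] .
  moreover have "order z (([:0, 1:] :: complex poly) ^ (n * (n - 1))) = 0" by (rule order_0I) (use z0 in simp)
  moreover have "([:0, 1:] :: complex poly) ^ (n * (n - 1)) \<noteq> 0" by simp
  ultimately show ?thesis
    by (cases "cleared_sum [:0, 1 :: complex:] (n - 1) = 0") (simp_all only: order_divides order_mult mult_eq_0_iff simp_thms add_0)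
qed

subsection \<open>Cyclotomic polynomials and congruences\<close>

text \<open>Complex polynomials split, so divisibility can be tested root by root; the induction
  removes one common linear factor.\<close>

lemma poly_dvd_if_order_le:
  fixes p q :: "complex poly"
  assumes "p \<noteq> 0" and "\<And>z. poly p z = 0 \<Longrightarrow> order z p \<le> order z q"
  shows "p dvd q"
  using assms
proof (induction "degree p" arbitrary: p q rule: less_induct)
  case less
  show ?case
  proof (cases "q = 0 \<or> degree p = 0")
    case True
    thus ?thesis
    proof
      assume "degree p = 0"
      with less.prems(1) have "is_unit p" by (simp add: is_unit_iff_degree)
      thus ?thesis by (rule unit_imp_dvd)
    qed simp
  next
    case False
    then obtain z where z: "poly p z = 0"
      using fundamental_theorem_of_algebra[of p] by (auto simp: constant_degree)
    hence "[:-z, 1:] dvd p" by (simp add: poly_eq_0_iff_dvd)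
    then obtain p' where p: "p = [:-z, 1:] * p'" ..
    have "order z p \<noteq> 0" using z less.prems(1) order_root by blast
    hence "order z q \<noteq> 0" using less.prems(2)[OF z] by simp
    hence "[:-z, 1:] dvd q" using order_root poly_eq_0_iff_dvd by blast
    then obtain q' where q: "q = [:-z, 1:] * q'" ..
    have nz: "p' \<noteq> 0" "q' \<noteq> 0" using False less.prems(1) p q by auto
    have "p' dvd q'"
    proof (rule less.hyps)
      have "degree p = 1 + degree p'" unfolding p using nz by (subst degree_mult_eq) auto
      thus "degree p' < degree p" by simp
      fix w assume w: "poly p' w = 0"
      have "order w p = order w [:-z, 1:] + order w p'" "order w q = order w [:-z, 1:] + order w q'"
        unfolding p q by (rule order_mult, use nz in \<open>simp only: mult_eq_0_iff\<close>, simp)+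
      moreover have "order w p \<le> order w q" by (rule less.prems(2)) (simp only: p poly_mult w mult_zero_right)
      ultimately show "order w p' \<le> order w q'" by simp
    qed (use nz in simp)
    thus ?thesis unfolding p q by (rule mult_dvd_mono[OF dvd_refl])
  qed
qed

lemma coprime_if_no_common_root:
  fixes p q :: "complex poly"
  assumes "q \<noteq> 0" and "\<And>z. poly q z = 0 \<Longrightarrow> poly p z \<noteq> 0"
  shows "coprime p q"
proof (rule coprimeI)
  fix c assume c: "c dvd p" "c dvd q"
  have "degree c = 0"
  proof (rule ccontr)
    assume "degree c \<noteq> 0"
    then obtain z where "poly c z = 0"
      using fundamental_theorem_of_algebra[of c] by (auto simp: constant_degree)
    with c have "poly p z = 0" "poly q z = 0" by (auto elim!: dvdE)
    thus False using assms(2) by blast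
  qed
  moreover have "c \<noteq> 0" using c assms(1) by auto
  ultimately show "is_unit c" by (simp add: is_unit_iff_degree)
qed

text \<open>Since \<open>V\<close> may share roots with \<open>P\<close>, the fraction is first
  reduced. At a root of \<open>P\<close> the reduced numerator vanishes to at least the order of
  \<open>P\<close>, so the reduced denominator, coprime to it, does not vanish there.\<close>

lemma ratfun_cong_0I:
  assumes V: "V \<noteq> 0" and P: "P \<noteq> 0"
    and dvd: "\<And>z. poly P z = 0 \<Longrightarrow> [:-z, 1:] ^ (order z V + order z P) dvd U"
  shows "ratfun_cong (Fract U V) 0 P"
proof -
  have 0: "coprime_denom 0 P"
    unfolding coprime_denom_def by (intro exI[of _ 0] exI[of _ 1]) (simp add: Zero_fract_def)
  have "\<exists>u v. v \<noteq> 0 \<and> coprime v P \<and> P dvd u \<and> Fract U V = Fract u v"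
  proof (cases "U = 0")
    case True
    thus ?thesis by (intro exI[of _ 0] exI[of _ 1]) (simp add: eq_fract V)
  next
    case False
    define u where "u = fst (quot_of_fract (Fract U V))"
    define v where "v = snd (quot_of_fract (Fract U V))"
    have v0: "v \<noteq> 0" and cop: "coprime u v" and eq: "Fract U V = Fract u v"
      unfolding u_def v_def by (simp_all add: coprime_quot_of_fract)
    from eq have UV: "U * v = u * V" using V v0 by (simp add: eq_fract)
    hence u0: "u \<noteq> 0" using False v0 by auto
    have le: "order z v + order z P \<le> order z u" if "poly P z = 0" for z
    proof -
      have "order z U + order z v = order z u + order z V"
        using arg_cong[OF UV, of "order z"] False v0 u0 V by (simp add: order_mult)
      moreover have "order z V + order z P \<le> order z U"
        using dvd[OF that] False by (simp add: order_divides)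
      ultimately show ?thesis by linarith
    qed
    have "P dvd u" using P le by (intro poly_dvd_if_order_le) fastforce+
    moreover have "coprime v P"
    proof (rule coprime_if_no_common_root[OF P])
      fix z assume z: "poly P z = 0"
      hence "order z P \<noteq> 0" using P order_root by blast
      with le[OF z] have "poly u z = 0" using order_root[of u z] by simp
      hence "[:-z, 1:] dvd u" by (simp add: poly_eq_0_iff_dvd)
      show "poly v z \<noteq> 0"
      proof
        assume "poly v z = 0"
        hence "[:-z, 1:] dvd v" by (simp add: poly_eq_0_iff_dvd)
        with cop \<open>[:-z, 1:] dvd u\<close> have "is_unit [:-z, 1:]" by (rule coprime_common_divisor)
        thus False by (simp add: is_unit_iff_degree)
      qed
    qed
    ultimately show ?thesis using v0 eq by blast
  qed
  thus ?thesis unfolding ratfun_cong_def using 0 by (auto simp: coprime_denom_def)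
qed

section \<open>Roots of cyclotomic polynomials and of q-integers\<close>

lemma cis_power_eq_1_iff:
  assumes "n > 0"
  shows "cis (2 * pi / real n) ^ m = 1 \<longleftrightarrow> n dvd m"
proof
  assume "cis (2 * pi / real n) ^ m = 1"
  hence "cis (real m * (2 * pi / real n)) = 1" by (simp only: DeMoivre)
  hence "cos (real m * (2 * pi / real n)) = 1" by (simp add: complex_eq_iff)
  then obtain i :: int where "real m * (2 * pi / real n) = of_int i * 2 * pi"
    by (auto simp: cos_one_2pi_int)
  hence "real m = of_int i * real n" using assms by (simp add: field_simps)
  hence "int m = i * int n" by (metis of_int_eq_iff of_int_mult of_int_of_nat_eq)
  thus "n dvd m" by (metis dvd_triv_right int_dvd_int_iff)
next
  assume "n dvd m"
  then obtain r where m: "m = n * r" ..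
  have "cis (2 * pi / real n) ^ n = 1" using assms by (simp add: DeMoivre)
  thus "cis (2 * pi / real n) ^ m = 1" by (simp add: m power_mult)
qed

lemma cyclotomic_poly_root:
  assumes n: "n > 0" and "poly (cyclotomic_poly n) z = 0"
  shows "z ^ m = 1 \<longleftrightarrow> n dvd m"
proof -
  obtain k where k: "coprime k n" and z: "z = cis (2 * pi * real k / real n)"
    using assms(2) unfolding cyclotomic_poly_def by (auto simp: poly_prod)
  have "z = cis (2 * pi / real n) ^ k" unfolding z by (simp add: DeMoivre mult_ac)
  hence "z ^ m = 1 \<longleftrightarrow> n dvd k * m"
    using cis_power_eq_1_iff[OF n, of "k * m"] by (simp add: power_mult)
  also have "\<dots> \<longleftrightarrow> n dvd m" using k by (simp add: coprime_dvd_mult_right_iff coprime_commute)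
  finally show ?thesis .
qed

text \<open>Distinct exponents in \<open>{1..n}\<close> differ by less than \<open>n\<close> and so
  give distinct roots.\<close>

lemma order_cyclotomic_poly_le:
  assumes n: "n > 1"
  shows "order z (cyclotomic_poly n) \<le> 1"
proof -
  define S where "S = {k \<in> {1..n}. coprime k n}"
  define f where "f k = cis (2 * pi * real k / real n)" for k
  define T where "T = {k \<in> S. f k = z}"
  have f: "f k = cis (2 * pi / real n) ^ k" for k unfolding f_def by (simp add: DeMoivre mult_ac)
  have "finite S" unfolding S_def by simp
  have "cyclotomic_poly n = (\<Prod>k\<in>S. [:- f k, 1:])" by (simp only: cyclotomic_poly_def S_def f_def)
  hence "order z (cyclotomic_poly n) = (\<Sum>k\<in>S. order z [:- f k, 1:])" by (simp add: order_prod)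
  also have "\<dots> = (\<Sum>k\<in>S. if f k = z then 1 else 0)"
  proof (rule sum.cong[OF refl])
    fix k
    show "order z [:- f k, 1:] = (if f k = z then 1 else 0)"
      using order_power_n_n[of z 1] by (auto intro: order_0I)
  qed
  also have "\<dots> = (\<Sum>k\<in>T. 1)" unfolding T_def by (rule sum.inter_filter[symmetric]) (rule \<open>finite S\<close>)
  also have "\<dots> = card T" by simp
  also have "card T \<le> 1"
  proof -
    have "\<not> i < j" if "i \<in> T" "j \<in> T" for i j
    proof
      assume "i < j"
      have "cis (2 * pi / real n) ^ i * cis (2 * pi / real n) ^ (j - i) = cis (2 * pi / real n) ^ i"
        unfolding power_add[symmetric] using that \<open>i < j\<close> by (simp add: T_def flip: f)
      hence "cis (2 * pi / real n) ^ (j - i) = 1" by simp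
      hence "n dvd j - i" using n by (simp add: cis_power_eq_1_iff)
      moreover have "j - i < n" using that \<open>i < j\<close> by (auto simp: T_def S_def)
      ultimately show False using \<open>i < j\<close> by (auto dest: dvd_imp_le)
    qed
    hence "\<forall>i\<in>T. \<forall>j\<in>T. i = j" by (metis linorder_neqE_nat)
    thus ?thesis using \<open>finite S\<close> by (simp add: card_le_Suc0_iff_eq T_def)
  qed
  finally show ?thesis .
qed

lemma q_integer_X: "(1 - [:0, 1:]) * q_integer [:0, 1 :: complex:] n = 1 - [:0, 1:] ^ n"
proof -
  have "(1 - [:0, 1:]) dvd 1 - [:0, 1 :: complex:] ^ n" by (simp only: one_diff_power_eq dvd_triv_left)
  thus ?thesis unfolding q_integer_def by (rule dvd_mult_div_cancel)
qed

text \<open>Serves to exclude \<open>1\<close> from the roots of the modulus.\<close>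

lemma poly_q_integer_X_1: "poly (q_integer [:0, 1 :: complex:] n) 1 = of_nat n"
proof -
  have "(1 - [:0, 1:]) * q_integer [:0, 1 :: complex:] n = (1 - [:0, 1:]) * (\<Sum>i<n. [:0, 1:] ^ i)"
    unfolding q_integer_X by (rule one_diff_power_eq)
  moreover have "1 - [:0, 1 :: complex:] \<noteq> 0" by (simp add: one_pCons)
  ultimately have "q_integer [:0, 1 :: complex:] n = (\<Sum>i<n. [:0, 1:] ^ i)" by (simp only: mult_cancel_left simp_thms)
  thus ?thesis by (simp add: poly_sum)
qed

lemma order_q_integer_X_le:
  fixes z :: complex
  assumes "n > 0" "z \<noteq> 0"
  shows "order z (q_integer [:0, 1:] n) \<le> 1"
proof -
  have "1 - [:0, 1:] ^ n \<noteq> (0 :: complex poly)" using X_power_inject[of 0 n] assms(1) by auto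
  hence "order z (q_integer [:0, 1:] n) \<le> order z (1 - [:0, 1:] ^ n)"
    unfolding q_integer_X[symmetric] by (intro dvd_imp_order_le dvd_triv_right)
  also have "\<dots> \<le> 1" using order_one_minus_X_power[OF assms] by simp
  finally show ?thesis .
qed

lemma multiplicative_order_exists:
  fixes z :: "'a::monoid_mult"
  assumes "n > 0" "z ^ n = 1"
  obtains d where "\<And>k. z ^ k = 1 \<longleftrightarrow> d dvd k"
proof -
  define d where "d = (LEAST d. d > 0 \<and> z ^ d = 1)"
  have d: "d > 0" "z ^ d = 1"
    using LeastI[of "\<lambda>d. d > 0 \<and> z ^ d = 1" n] assms unfolding d_def by auto
  have "z ^ k = 1 \<longleftrightarrow> d dvd k" for k
  proof -
    have "z ^ k = (z ^ d) ^ (k div d) * z ^ (k mod d)"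
      unfolding power_mult[symmetric] power_add[symmetric] by simp
    hence k: "z ^ k = z ^ (k mod d)" by (simp add: d)
    moreover have "z ^ (k mod d) \<noteq> 1" if "k mod d > 0"
      using not_less_Least[of "k mod d" "\<lambda>d. d > 0 \<and> z ^ d = 1"] that d(1) unfolding d_def[symmetric] by auto
    ultimately show ?thesis by (auto simp: dvd_eq_mod_eq_0)
  qed
  thus ?thesis by (rule that)
qed

section \<open>The sum as a quotient of polynomials, and the congruence\<close>

lemma q_pochhammer_terms:
  fixes q :: "'a::field"
  shows "q_pochhammer q (q\<^sup>2) k ^ 3 * q_pochhammer q (q ^ 4) k
      / (q_pochhammer (q\<^sup>2) (q\<^sup>2) k * q_pochhammer (q ^ 4) (q ^ 4) k ^ 3) * q ^ (k\<^sup>2 + k)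
    = (\<Prod>j<k. term_num q j / term_den q j)"
proof -
  have p: "q * (q\<^sup>2) ^ j = q ^ (2 * j + 1)" "q * (q ^ 4) ^ j = q ^ (4 * j + 1)"
    "q\<^sup>2 * (q\<^sup>2) ^ j = q ^ (2 * j + 2)" "q ^ 4 * (q ^ 4) ^ j = q ^ (4 * j + 4)" for j
    by (simp_all add: power_mult[symmetric] power_add[symmetric] add.commute)
  have e: "q ^ (k\<^sup>2 + k) = (\<Prod>j<k. q ^ (2 * j + 2))"
  proof (induction k)
    case (Suc k)
    have k: "(Suc k)\<^sup>2 + Suc k = (k\<^sup>2 + k) + (2 * k + 2)" by (simp add: power2_eq_square)
    show ?case unfolding k power_add[of q "k\<^sup>2 + k" "2 * k + 2"] Suc.IH by simp
  qed simp
  show ?thesis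
    unfolding q_pochhammer_def p e term_num_def term_den_def prod_dividef prod.distrib prod_power_distrib
    by simp
qed

lemma sum_eq_Fract:
  fixes q :: "complex poly fract"
  defines "q \<equiv> to_fract [:0, 1:]"
  shows "(\<Sum>k = 0..m. q_integer q (6 * k + 1)
         * (q_pochhammer q (q\<^sup>2) k ^ 3 * q_pochhammer q (q ^ 4) k)
         / (q_pochhammer (q\<^sup>2) (q\<^sup>2) k * q_pochhammer (q ^ 4) (q ^ 4) k ^ 3) * q ^ (k\<^sup>2 + k))
    = Fract (cleared_sum [:0, 1:] m) ((1 - [:0, 1:]) * (\<Prod>j<m. term_den [:0, 1:] j))"
proof -
  interpret unital_ring_hom to_fract by (rule unital_ring_hom_to_fract)
  have "q ^ k \<noteq> 1" if "k > 0" for k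
  proof -
    have "[:0, 1 :: complex:] ^ k \<noteq> 1" using X_power_inject[of k 0] that by auto
    thus ?thesis unfolding q_def by (metis hom_power hom_one to_fract_eq_iff)
  qed
  hence q1: "1 - q ^ k \<noteq> 0" if "k > 0" for k using that by simp
  have d0: "term_den q j \<noteq> 0" for j
    using q1[of "2 * j + 2"] q1[of "4 * j + 4"] unfolding term_den_def
    by (simp only: mult_eq_0_iff power_eq_0_iff) simp
  have "(\<Sum>k = 0..m. q_integer q (6 * k + 1)
         * (q_pochhammer q (q\<^sup>2) k ^ 3 * q_pochhammer q (q ^ 4) k)
         / (q_pochhammer (q\<^sup>2) (q\<^sup>2) k * q_pochhammer (q ^ 4) (q ^ 4) k ^ 3) * q ^ (k\<^sup>2 + k))
    = (\<Sum>k\<le>m. (1 - q ^ (6 * k + 1)) * (\<Prod>j<k. term_num q j) * (\<Prod>j\<in>{k..<m}. term_den q j)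
         / ((1 - q) * (\<Prod>j<m. term_den q j)))"
    unfolding atLeast0AtMost
  proof (rule sum.cong[OF refl])
    fix k assume "k \<in> {..m}"
    hence "(\<Prod>j<m. term_den q j) = (\<Prod>j<k. term_den q j) * (\<Prod>j\<in>{k..<m}. term_den q j)"
      by (metis atLeast0LessThan atMost_iff prod.atLeastLessThan_concat zero_le)
    moreover have "(\<Prod>j<k. term_den q j) \<noteq> 0" "(\<Prod>j\<in>{k..<m}. term_den q j) \<noteq> 0" using d0 by simp_all
    ultimately have "(1 - q ^ (6 * k + 1)) / (1 - q) * (\<Prod>j<k. term_num q j / term_den q j)
       = (1 - q ^ (6 * k + 1)) * (\<Prod>j<k. term_num q j) * (\<Prod>j\<in>{k..<m}. term_den q j)
         / ((1 - q) * (\<Prod>j<m. term_den q j))"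
      by (simp add: prod_dividef)
    thus "q_integer q (6 * k + 1)
         * (q_pochhammer q (q\<^sup>2) k ^ 3 * q_pochhammer q (q ^ 4) k)
         / (q_pochhammer (q\<^sup>2) (q\<^sup>2) k * q_pochhammer (q ^ 4) (q ^ 4) k ^ 3) * q ^ (k\<^sup>2 + k)
       = (1 - q ^ (6 * k + 1)) * (\<Prod>j<k. term_num q j) * (\<Prod>j\<in>{k..<m}. term_den q j)
         / ((1 - q) * (\<Prod>j<m. term_den q j))"
      unfolding q_pochhammer_terms[symmetric] q_integer_def by (simp add: mult.assoc)
  qed
  also have "\<dots> = cleared_sum q m / ((1 - q) * (\<Prod>j<m. term_den q j))"
    unfolding cleared_sum_def sum_divide_distrib ..
  also have "\<dots> = to_fract (cleared_sum [:0, 1:] m) / to_fract ((1 - [:0, 1:]) * (\<Prod>j<m. term_den [:0, 1:] j))"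
    unfolding hom_cleared_sum hom_mult hom_prod hom_term_den hom_diff hom_one q_def ..
  finally show ?thesis by (simp only: Fract_conv_to_fract)
qed

theorem theorem1p1:
  fixes n :: nat and X :: "complex poly" and q :: "complex poly fract"
  defines "X \<equiv> [:0, 1:]"
  defines "q \<equiv> to_fract X"
  assumes "n > 0" and "n mod 4 = 3"
  shows "ratfun_cong
    (\<Sum>k = 0..n - 1.
       q_integer q (6 * k + 1)
         * (q_pochhammer q (q\<^sup>2) k ^ 3 * q_pochhammer q (q ^ 4) k)
         / (q_pochhammer (q\<^sup>2) (q\<^sup>2) k * q_pochhammer (q ^ 4) (q ^ 4) k ^ 3)
         * q ^ (k\<^sup>2 + k))
    0
    (q_integer X n * cyclotomic_poly n ^ 3)"
  unfolding q_def X_def sum_eq_Fract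
proof (rule ratfun_cong_0I)
  let ?X = "[:0, 1 :: complex:]"
  let ?V = "\<Prod>j<n - 1. term_den ?X j"
  have n1: "n > 1" using assms(4) by presburger
  have Xne: "1 - ?X ^ k \<noteq> 0" if "k > 0" for k using X_power_inject[of 0 k] that by auto
  have V0: "?V \<noteq> 0" by (simp add: term_den_X_neq_0)
  have X1: "1 - ?X \<noteq> 0" using Xne[of 1] by simp
  show "(1 - ?X) * ?V \<noteq> 0" using X1 V0 by (simp only: mult_eq_0_iff simp_thms)
  have q0: "q_integer ?X n \<noteq> 0" using q_integer_X[of n] Xne[OF assms(3)] by force
  have c0: "cyclotomic_poly n \<noteq> 0" unfolding cyclotomic_poly_def by simp
  show "q_integer ?X n * cyclotomic_poly n ^ 3 \<noteq> 0" using q0 c0 by simp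
  fix z assume root: "poly (q_integer ?X n * cyclotomic_poly n ^ 3) z = 0"
  \<comment> \<open>Because \<open>z\<close> is not \<open>1\<close>, the factor
    \<open>1 - ?X\<close> adds nothing to the order of the denominator.\<close>
  have z: "z ^ n = 1 \<and> z \<noteq> 1"
  proof (cases "poly (cyclotomic_poly n) z = 0")
    case True
    from cyclotomic_poly_root[OF assms(3) this, of n] cyclotomic_poly_root[OF assms(3) this, of 1] n1
    show ?thesis by simp
  next
    case False
    hence "poly (q_integer ?X n) z = 0" using root by simp
    moreover have "poly ((1 - ?X) * q_integer ?X n) z = 1 - z ^ n" unfolding q_integer_X by simp
    ultimately show ?thesis using poly_q_integer_X_1[of n] n1 by auto
  qed
  hence z0: "z \<noteq> 0" using assms(3) by (auto simp: power_0_left)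
  obtain d where d: "\<And>k. z ^ k = 1 \<longleftrightarrow> d dvd k"
    using multiplicative_order_exists[OF assms(3)] z by blast
  hence "d dvd n" using z by blast
  then obtain l where l: "n = d * l" ..
  have "odd n" using assms(4) by presburger
  hence od: "odd d" and l0: "l > 0" unfolding l using assms(3) l by auto
  have "order z (1 - ?X) = 0" using z by (intro order_0I) auto
  hence oV: "order z ((1 - ?X) * ?V) = 4 * (l - 1)"
    using order_prod_term_den[OF d od l0] X1 V0 unfolding l[symmetric] by (subst order_mult) simp_all
  have oP: "order z (q_integer ?X n * cyclotomic_poly n ^ 3) = order z (q_integer ?X n) + 3 * order z (cyclotomic_poly n)"
    using q0 c0 by (simp add: order_mult order_power)
  show "[:-z, 1:] ^ (order z ((1 - ?X) * ?V) + order z (q_integer ?X n * cyclotomic_poly n ^ 3))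
    dvd cleared_sum ?X (n - 1)"
  proof (cases "poly (cyclotomic_poly n) z = 0")
    case True
    \<comment> \<open>At a primitive root \<open>l = 1\<close>: the denominator has order
      \<open>0\<close> and the modulus at most \<open>1 + 3\<close>.\<close>
    have "n dvd d" using cyclotomic_poly_root[OF assms(3) True, of d] d[of d] by simp
    hence "n = d" using \<open>d dvd n\<close> by (rule dvd_antisym)
    hence "l = 1" using l assms(3) by simp
    hence "order z ((1 - ?X) * ?V) + order z (q_integer ?X n * cyclotomic_poly n ^ 3) \<le> 4"
      unfolding oV oP using order_q_integer_X_le[OF assms(3) z0] order_cyclotomic_poly_le[OF n1, of z] by simp
    thus ?thesis by (rule power_le_dvd[OF cleared_sum_dvd_primitive[OF conjunct1[OF z] assms(4)]])
  next
    case False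
    \<comment> \<open>Here only \<open>[n]\<close> contributes to the modulus, and at most once, on
      top of the order \<open>4 * (l - 1)\<close> of the denominator.\<close>
    hence "order z (cyclotomic_poly n) = 0" by (rule order_0I)
    hence "order z ((1 - ?X) * ?V) + order z (q_integer ?X n * cyclotomic_poly n ^ 3) \<le> 4 * (l - 1) + 1"
      unfolding oV oP using order_q_integer_X_le[OF assms(3) z0] by simp
    thus ?thesis unfolding l by (rule power_le_dvd[OF cleared_sum_dvd[OF d od l0]])
  qed
qed

end
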